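(* Let $X$ be an uncountable Polish space, let $f : X \to \mathbb{R}$ be a bounded Baire class 1 function, and let $\lambda$ be an ordinal with $1 \le \lambda < \omega_1$. Then $f \in \mathscr{B}_1^\lambda$ if and only if $\operatorname{length}_1(f) \le \omega^\lambda$.
   Context: A function $f : X \to \mathbb{R}$ is of Baire class 1 if it is the pointwise limit of a sequence of continuous functions (equivalently, $\{f<c\},\{f>c\} \in \boldsymbol{\Sigma}^0_2$ for all $c \in \mathbb{R}$). A function $g: X \to \mathbb{R}$ is upper semi-continuous (USC) if $\{x : g(x) < c\}$ is open for every $c \in \mathbb{R}$. An ordinal is even (odd) if it has the form $\mu + n$ with $\mu$ limit or $0$ and $n$ an even (odd) natural number; $(-1)^\theta$ is $1$ if $\theta$ is even and $-1$ if $\theta$ is odd. Separation by transfinite differences. Consider a decreasing sequence $(F_\eta)_{\eta<\mu}$ ($\mu<\omega_1$) of closed subsets of $X$ that is continuous (for every limit ordinal $\theta<\mu$, $F_\theta = \bigcap_{\eta<\theta}F_\eta$), with $F_0 = X$, and with $\bigcap_{\eta<\mu}F_\eta = \emptyset$ if $\mu$ is limit. Put $F_\eta=\emptyset$ for $\eta \ge \mu$. Sets $A, B \subseteq X$ can be separated by the transfinite difference of this sequence if $$A \subseteq \bigcup_{\eta<\mu,\ \eta \text{ even}} F_\eta\setminus F_{\eta+1} \subseteq X \setminus B .$$ $\alpha_1(A,B)$ is the least length $\mu$ of such a sequence if one exists, and $\omega_1$ otherwise. For a Baire class 1 function $f$, $$\alpha_1(f) = \sup_{p<q,\ p,q\in\mathbb{Q}}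 \alpha_1(\{f\le p\},\{f\ge q\}).$$ $\mathscr{B}_1^\lambda$ is the set of bounded Baire class 1 functions $f$ on $X$ with $\alpha_1(f)\le\omega^\lambda$. Alternating sums. $\mathrm{DUSB}_1$ is the set of transfinite (pointwise) decreasing sequences $(f_\eta)_{\eta<\mu}$, $\mu<\omega_1$, of non-negative bounded USC functions on $X$ such that, if $\mu$ is limit, $f_\eta\to 0$ pointwise as $\eta\to\mu$. For such a sequence the alternating sum $\sum^*_{\eta<\theta}(-1)^\eta f_\eta$ ($\theta\le\mu$) is defined inductively: it is $0$ for $\theta=0$; $$\sum^*_{\eta<\theta+1}(-1)^\eta f_\eta = \sum^*_{\eta<\theta}(-1)^\eta f_\eta + (-1)^\theta f_\theta;$$ and for limit $\theta$, $$\sum^*_{\eta<\theta}(-1)^\eta f_\eta = \sup\Big\{\sum^*_{\eta<\zeta}(-1)^\eta f_\eta : \zeta<\theta,\ \zeta \text{ even}\Big\}$$ (pointwise supremum). $\operatorname{length}_1(f)$ is the least $\mu$ for which there exist $(f_\eta)_{\eta<\mu}\in\mathrm{DUSB}_1$ and $c\in\mathbb{R}$ with $f = c+\sum^*_{\eta<\mu}(-1)^\eta f_\eta$, and it is $\omega_1$ if no such $\mu$ exists. *)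

theory Defs
  imports "HOL-Analysis.Analysis" "HOL-Library.Countable_Set_Type"
begin

text \<open>
  The elements of \<open>ordinal\<close> are the ordinals below \<open>\<omega>\<^sub>2\<close>.  This is an initial segment of the
  ordinals that contains \<open>\<omega>\<^sub>1\<close> as an element and is closed under successors and under suprema of
  families of size at most \<open>\<aleph>\<^sub>1\<close>.
\<close>

typedef ordinal = "Field (cardSuc (cardSuc natLeq))"
  using Field_cardSuc_not_empty[OF cardSuc_Card_order[OF natLeq_Card_order]] by blast

lemma Well_order_ordinal: "Well_order (cardSuc (cardSuc natLeq))"
  by (intro cardSuc_Well_order cardSuc_Card_order natLeq_Card_order)

instantiation ordinal :: linorder
begin

definition less_eq_ordinal :: "ordinal \<Rightarrow> ordinal \<Rightarrow> bool" where
  "a \<le> b \<longleftrightarrow> (Rep_ordinal a, Rep_ordinal b) \<in> cardSuc (cardSuc natLeq)"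

definition less_ordinal :: "ordinal \<Rightarrow> ordinal \<Rightarrow> bool" where
  "(a :: ordinal) < b \<longleftrightarrow> a \<le> b \<and> \<not> b \<le> a"

instance
proof
  fix a b c :: ordinal
  let ?r = "cardSuc (cardSuc natLeq)"
  have lin: "Linear_order ?r"
    using Well_order_ordinal by (simp add: well_order_on_def)
  then have refl: "Refl ?r" and tr: "trans ?r" and asym: "antisym ?r" and tot: "Total ?r"
    by (auto simp: linear_order_on_def partial_order_on_def preorder_on_def)
  show "(a :: ordinal) < b \<longleftrightarrow> a \<le> b \<and> \<not> b \<le> a"
    by (rule less_ordinal_def)
  show "a \<le> a"
    using refl Rep_ordinal[of a] by (auto simp: less_eq_ordinal_def refl_on_def)
  show "a \<le> b \<Longrightarrow> b \<le> c \<Longrightarrow> a \<le> c"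
    unfolding less_eq_ordinal_def using tr by (meson transD)
  show "a \<le> b \<Longrightarrow> b \<le> a \<Longrightarrow> a = b"
    unfolding less_eq_ordinal_def using asym by (metis antisymD Rep_ordinal_inject)
  show "a \<le> b \<or> b \<le> a"
    unfolding less_eq_ordinal_def
    using tot refl Rep_ordinal[of a] Rep_ordinal[of b]
    by (cases "Rep_ordinal a = Rep_ordinal b") (auto simp: total_on_def refl_on_def)
qed

end

instance ordinal :: wellorder
proof
  fix P :: "ordinal \<Rightarrow> bool" and a
  assume step: "\<And>x. (\<And>y. y < x \<Longrightarrow> P y) \<Longrightarrow> P x"
  let ?r = "cardSuc (cardSuc natLeq)"
  have "wf (?r - Id)"
    using Well_order_ordinal by (simp add: well_order_on_def)
  then have "wf (inv_image (?r - Id) Rep_ordinal)"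
    by (rule wf_inv_image)
  moreover have "{(x, y). x < y} \<subseteq> inv_image (?r - Id) Rep_ordinal"
    by (auto simp: inv_image_def less_eq_ordinal_def[symmetric] Rep_ordinal_inject)
  ultimately have "wf {(x, y :: ordinal). x < y}"
    by (rule wf_subset)
  then show "P a"
    by (rule wf_induct_rule) (use step in auto)
qed

lemma infinite_Field_cardSuc_natLeq: "infinite (Field (cardSuc natLeq))"
  using cardSuc_finite[OF natLeq_Card_order] by (simp add: Field_natLeq)

lemma ordinal_no_max: "\<exists>b. a < (b :: ordinal)"
proof -
  let ?r = "cardSuc (cardSuc natLeq)"
  have "Card_order ?r"
    by (intro cardSuc_Card_order natLeq_Card_order)
  moreover have "infinite (Field ?r)"
    using cardSuc_finite[OF cardSuc_Card_order[OF natLeq_Card_order]]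
      infinite_Field_cardSuc_natLeq by blast
  ultimately obtain y where y: "y \<in> Field ?r" "Rep_ordinal a \<noteq> y" "(Rep_ordinal a, y) \<in> ?r"
    using infinite_Card_order_limit[OF _ _ Rep_ordinal] by blast
  then have "a \<le> Abs_ordinal y" "a \<noteq> Abs_ordinal y"
    by (auto simp: less_eq_ordinal_def Abs_ordinal_inverse)
  then have "a < Abs_ordinal y"
    by simp
  then show ?thesis ..
qed

instantiation ordinal :: "{zero, one, conditionally_complete_linorder}"
begin

definition zero_ordinal :: ordinal where
  "zero_ordinal = (LEAST a. True)"

definition one_ordinal :: ordinal where
  "one_ordinal = (LEAST a. 0 < a)"

definition inf_ordinal :: "ordinal \<Rightarrow> ordinal \<Rightarrow> ordinal" where
  "inf_ordinal = min"

definition sup_ordinal :: "ordinal \<Rightarrow> ordinal \<Rightarrow> ordinal" where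
  "sup_ordinal = max"

definition Inf_ordinal :: "ordinal set \<Rightarrow> ordinal" where
  "Inf A = (LEAST a :: ordinal. a \<in> A)"

definition Sup_ordinal :: "ordinal set \<Rightarrow> ordinal" where
  "Sup A = (LEAST b :: ordinal. \<forall>a\<in>A. a \<le> b)"

instance
proof
  fix x y z :: ordinal and A :: "ordinal set"
  show "inf x y \<le> x" "inf x y \<le> y" "x \<le> y \<Longrightarrow> x \<le> z \<Longrightarrow> x \<le> inf y z"
    by (auto simp: inf_ordinal_def)
  show "x \<le> sup x y" "y \<le> sup x y" "y \<le> x \<Longrightarrow> z \<le> x \<Longrightarrow> sup y z \<le> x"
    by (auto simp: sup_ordinal_def)
  show "x \<in> A \<Longrightarrow> bdd_below A \<Longrightarrow> Inf A \<le> x"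
    by (auto simp: Inf_ordinal_def intro: Least_le)
  show "A \<noteq> {} \<Longrightarrow> (\<And>a. a \<in> A \<Longrightarrow> z \<le> a) \<Longrightarrow> z \<le> Inf A"
    unfolding Inf_ordinal_def by (rule LeastI2_ex) auto
  show "x \<in> A \<Longrightarrow> bdd_above A \<Longrightarrow> x \<le> Sup A"
    unfolding Sup_ordinal_def bdd_above_def by (rule LeastI2_ex) auto
  show "A \<noteq> {} \<Longrightarrow> (\<And>a. a \<in> A \<Longrightarrow> a \<le> z) \<Longrightarrow> Sup A \<le> z"
    unfolding Sup_ordinal_def by (auto intro: Least_le)
qed

end

definition osucc :: "ordinal \<Rightarrow> ordinal" where
  "osucc a = (LEAST b. a < b)"

definition is_limit :: "ordinal \<Rightarrow> bool" where
  "is_limit a \<longleftrightarrow> a \<noteq> 0 \<and> (\<forall>b<a. osucc b < a)"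

definition omega :: ordinal where
  "omega = (LEAST a. is_limit a)"

definition omega1 :: ordinal where
  "omega1 = (LEAST a. uncountable {..<a})"

lemma ordinal_zero_le [simp]: "0 \<le> (a :: ordinal)"
  by (simp add: zero_ordinal_def Least_le)

lemma osucc_greater [simp]: "a < osucc a"
  unfolding osucc_def using ordinal_no_max by (rule LeastI_ex)

lemma osucc_le_iff: "osucc a \<le> b \<longleftrightarrow> a < b"
proof
  show "osucc a \<le> b \<Longrightarrow> a < b"
    using osucc_greater by (rule order_less_le_trans)
  show "a < b \<Longrightarrow> osucc a \<le> b"
    unfolding osucc_def by (rule Least_le)
qed

lemma less_osucc_iff: "a < osucc b \<longleftrightarrow> a \<le> b"
  using osucc_le_iff[of b a] by (simp add: not_le[symmetric] del: not_le)

lemma osucc_inject [simp]: "osucc a = osucc b \<longleftrightarrow> a = b"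
proof
  assume "osucc a = osucc b"
  then have "a < osucc b" "b < osucc a"
    using osucc_greater[of a] osucc_greater[of b] by argo+
  then show "a = b"
    unfolding less_osucc_iff by (rule order_antisym)
qed simp

lemma osucc_neq_zero [simp]: "osucc a \<noteq> 0"
proof -
  have "0 < osucc a"
    using ordinal_zero_le osucc_greater by (rule order_le_less_trans)
  then show ?thesis by simp
qed

lemma not_is_limit_zero [simp]: "\<not> is_limit 0"
  by (simp add: is_limit_def)

lemma not_is_limit_osucc [simp]: "\<not> is_limit (osucc a)"
  using is_limit_def osucc_greater by blast

lemma one_ordinal_eq: "(1 :: ordinal) = osucc 0"
  by (simp add: one_ordinal_def osucc_def)

lemma ordinal_cases [case_names zero succ limit]:
  obtains "a = 0" | b where "a = osucc b" | "is_limit a"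
proof (cases "a = 0 \<or> is_limit a")
  case False
  then obtain b where b: "b < a" "\<not> osucc b < a"
    unfolding is_limit_def by blast
  then have "a = osucc b"
    using osucc_le_iff[of b a] by simp
  then show ?thesis
    using that by blast
qed (use that in blast)

context
  includes cardinal_syntax
begin

lemma ordinal_bdd_above:
  assumes "|A| \<le>o cardSuc natLeq"
  shows "bdd_above (A :: ordinal set)"
proof (rule ccontr)
  assume unbdd: "\<not> bdd_above A"
  let ?r = "cardSuc (cardSuc natLeq)"
  have C: "Card_order (cardSuc natLeq)"
    by (intro cardSuc_Card_order natLeq_Card_order)
  have reg: "regularCard ?r"
    using infinite_cardSuc_regularCard infinite_Field_cardSuc_natLeq C by blast
  have "cofinal (Rep_ordinal ` A) ?r"
    unfolding cofinal_def
  proof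
    fix y assume y: "y \<in> Field ?r"
    obtain a where "a \<in> A" "Abs_ordinal y < a"
      using unbdd unfolding bdd_above_def by (metis linorder_not_le)
    then show "\<exists>b\<in>Rep_ordinal ` A. y \<noteq> b \<and> (y, b) \<in> ?r"
      using y by (auto simp: less_le less_eq_ordinal_def Abs_ordinal_inverse Rep_ordinal_inverse)
  qed
  moreover have "Rep_ordinal ` A \<subseteq> Field ?r"
    using Rep_ordinal by blast
  ultimately have "|Rep_ordinal ` A| =o ?r"
    using reg unfolding regularCard_def by blast
  then have "?r \<le>o |A|"
    using card_of_image[of Rep_ordinal A] ordIso_symmetric ordIso_ordLeq_trans by blast
  then have "?r \<le>o cardSuc natLeq"
    using assms ordLeq_transitive by blast
  then show False
    using cardSuc_greater[OF C] not_ordLess_ordLeq by blast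
qed

lemma countable_imp_bdd_above_ordinal: "countable A \<Longrightarrow> bdd_above (A :: ordinal set)"
proof (rule ordinal_bdd_above)
  assume "countable A"
  then have "|A| \<le>o natLeq"
    by (metis countable_card_le_natLeq)
  then show "|A| \<le>o cardSuc natLeq"
    using cardSuc_ordLeq[OF natLeq_Card_order] ordLeq_transitive by blast
qed

lemma uncountable_lessThan_omega1: "uncountable {..<omega1}"
proof -
  let ?s = "cardSuc natLeq"
  have Cs: "Card_order ?s"
    by (intro cardSuc_Card_order natLeq_Card_order)
  have Fs: "|Field ?s| =o ?s"
    using Cs by (rule card_of_Field_ordIso)
  have bij: "bij_betw Rep_ordinal UNIV (Field (cardSuc ?s))"
    unfolding bij_betw_def inj_on_def type_definition.Rep_range[OF type_definition_ordinal]
    by (simp add: Rep_ordinal_inject)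
  have "|Field (cardSuc ?s)| =o |UNIV :: ordinal set|"
    by (rule ordIso_symmetric[OF card_of_ordIsoI[OF bij]])
  moreover have "cardSuc ?s =o |Field (cardSuc ?s)|"
    by (rule ordIso_symmetric[OF card_of_Field_ordIso[OF cardSuc_Card_order[OF Cs]]])
  ultimately have "cardSuc ?s =o |UNIV :: ordinal set|"
    by (rule ordIso_transitive[rotated])
  then have "?s \<le>o |UNIV :: ordinal set|"
    by (rule ordLeq_ordIso_trans[OF cardSuc_ordLeq[OF Cs]])
  then have "|Field ?s| \<le>o |UNIV :: ordinal set|"
    by (rule ordIso_ordLeq_trans[OF Fs])
  then obtain g :: "nat set \<Rightarrow> ordinal" where g: "inj_on g (Field ?s)"
    unfolding card_of_ordLeq[symmetric] by auto
  have "|g ` Field ?s| \<le>o ?s"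
    by (rule ordLeq_ordIso_trans[OF card_of_image Fs])
  then obtain b where b: "\<And>y. y \<in> g ` Field ?s \<Longrightarrow> y \<le> b"
    using ordinal_bdd_above unfolding bdd_above_def by blast
  have unc: "uncountable (Field ?s)"
  proof
    assume "countable (Field ?s)"
    then have "|Field ?s| \<le>o natLeq"
      by (simp add: countable_card_le_natLeq)
    then have "?s \<le>o natLeq"
      by (rule ordIso_ordLeq_trans[OF ordIso_symmetric[OF Fs]])
    then show False
      using cardSuc_greater[OF natLeq_Card_order] not_ordLess_ordLeq by blast
  qed
  have sub: "g ` Field ?s \<subseteq> {..<osucc b}"
    using b by (auto simp: less_osucc_iff)
  have "uncountable {..<osucc b}"
  proof
    assume "countable {..<osucc b}"
    then have "countable (g ` Field ?s)"
      by (rule countable_subset[OF sub])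
    then show False
      using unc g by (blast dest: countable_image_inj_on)
  qed
  then show ?thesis
    unfolding omega1_def by (rule LeastI)
qed

end

lemma less_omega1_iff: "a < omega1 \<longleftrightarrow> countable {..<a}"
proof
  show "a < omega1 \<Longrightarrow> countable {..<a}"
    unfolding omega1_def using not_less_Least by blast
  assume *: "countable {..<a}"
  show "a < omega1"
  proof (rule ccontr)
    assume "\<not> a < omega1"
    then have "{..<omega1} \<subseteq> {..<a}"
      by simp
    then have "countable {..<omega1}"
      using * by (rule countable_subset)
    then show False
      using uncountable_lessThan_omega1 by contradiction
  qed
qed

definition even_ord :: "ordinal \<Rightarrow> bool" where
  "even_ord a \<longleftrightarrow> (\<exists>b n. (b = 0 \<or> is_limit b) \<and> even n \<and> a = (osucc ^^ n) b)"

definition odd_ord :: "ordinal \<Rightarrow> bool" where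
  "odd_ord a \<longleftrightarrow> (\<exists>b n. (b = 0 \<or> is_limit b) \<and> odd n \<and> a = (osucc ^^ n) b)"

lemma osucc_funpow_unique:
  assumes b: "b = 0 \<or> is_limit b" and c: "c = 0 \<or> is_limit c"
    and eq: "(osucc ^^ m) b = (osucc ^^ n) c"
  shows "m = n"
  using eq
proof (induction m arbitrary: n)
  case 0
  show ?case
  proof (cases n)
    case (Suc k)
    with 0 have "b = osucc ((osucc ^^ k) c)"
      by simp
    with b show ?thesis
      using osucc_neq_zero not_is_limit_osucc by metis
  qed simp
next
  case (Suc m)
  show ?case
  proof (cases n)
    case 0
    with Suc.prems have "c = osucc ((osucc ^^ m) b)"
      by simp
    with c show ?thesis
      using osucc_neq_zero not_is_limit_osucc by metis
  next
    case (Suc k)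
    with Suc.prems have "(osucc ^^ m) b = (osucc ^^ k) c"
      by simp
    then show ?thesis
      using Suc Suc.IH by simp
  qed
qed

lemma odd_ord_iff: "odd_ord a \<longleftrightarrow> \<not> even_ord a"
proof -
  have "\<exists>b n. (b = 0 \<or> is_limit b) \<and> a = (osucc ^^ n) b"
  proof (induction a rule: less_induct)
    case (less a)
    show ?case
    proof (cases a rule: ordinal_cases)
      case (succ c)
      then obtain b n where "b = 0 \<or> is_limit b" "c = (osucc ^^ n) b"
        using less.IH[of c] by auto
      then have "(b = 0 \<or> is_limit b) \<and> a = (osucc ^^ Suc n) b"
        using succ by simp
      then show ?thesis by blast
    next
      case zero
      then show ?thesis by (intro exI[of _ a] exI[of _ 0]) simp
    next
      case limit
      then show ?thesis by (intro exI[of _ a] exI[of _ 0]) simp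
    qed
  qed
  then obtain b n where bn: "b = 0 \<or> is_limit b" "a = (osucc ^^ n) b"
    by blast
  have "m = n" if "c = 0 \<or> is_limit c" "a = (osucc ^^ m) c" for c m
    using osucc_funpow_unique[OF that(1) bn(1)] that(2) bn(2) by simp
  then have "even_ord a \<longleftrightarrow> even n" "odd_ord a \<longleftrightarrow> odd n"
    unfolding even_ord_def odd_ord_def using bn by blast+
  then show ?thesis
    by simp
qed

definition ord_sign :: "ordinal \<Rightarrow> real" where
  "ord_sign a = (if even_ord a then 1 else -1)"

lemma ordinal_limit_cases:
  obtains "a = 0" | b where "a = osucc b" | b where "is_limit b" "a = b"
  by (cases a rule: ordinal_cases) auto

lemma ordinal_pair_cases:
  obtains c where "p = (c, 0 :: ordinal)" | c b where "p = (c, osucc b)" | c b where "is_limit b" "p = (c, b)"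
  by (cases p, cases "snd p" rule: ordinal_cases) auto

function oplus :: "ordinal \<Rightarrow> ordinal \<Rightarrow> ordinal" where
  "oplus a 0 = a"
| "oplus a (osucc b) = osucc (oplus a b)"
| "is_limit b \<Longrightarrow> oplus a b = (SUP c\<in>{..<b}. oplus a c)"
proof -
  fix P :: bool and p :: "ordinal \<times> ordinal"
  assume "\<And>a. p = (a, 0) \<Longrightarrow> P" "\<And>a b. p = (a, osucc b) \<Longrightarrow> P"
    "\<And>b a. is_limit b \<Longrightarrow> p = (a, b) \<Longrightarrow> P"
  then show P by (rule ordinal_pair_cases)
qed auto
termination
  by (relation "inv_image {(b, b'). b < b'} snd") (auto simp: wf)

function otimes :: "ordinal \<Rightarrow> ordinal \<Rightarrow> ordinal" where
  "otimes a 0 = 0"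
| "otimes a (osucc b) = oplus (otimes a b) a"
| "is_limit b \<Longrightarrow> otimes a b = (SUP c\<in>{..<b}. otimes a c)"
proof -
  fix P :: bool and p :: "ordinal \<times> ordinal"
  assume "\<And>a. p = (a, 0) \<Longrightarrow> P" "\<And>a b. p = (a, osucc b) \<Longrightarrow> P"
    "\<And>b a. is_limit b \<Longrightarrow> p = (a, b) \<Longrightarrow> P"
  then show P by (rule ordinal_pair_cases)
qed auto
termination
  by (relation "inv_image {(b, b'). b < b'} snd") (auto simp: wf)

function omega_pow :: "ordinal \<Rightarrow> ordinal" where
  "omega_pow 0 = 1"
| "omega_pow (osucc b) = otimes (omega_pow b) omega"
| "is_limit b \<Longrightarrow> omega_pow b = (SUP c\<in>{..<b}. omega_pow c)"
proof -
  fix P :: bool and p :: "ordinal"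
  assume "p = 0 \<Longrightarrow> P" "\<And>b. p = osucc b \<Longrightarrow> P"
    "\<And>b. is_limit b \<Longrightarrow> p = b \<Longrightarrow> P"
  then show P by (rule ordinal_limit_cases)
qed auto
termination
  by (relation "{(b, b'). b < b'}") (auto simp: wf)

definition baire_class_1 :: "('a::topological_space \<Rightarrow> real) \<Rightarrow> bool" where
  "baire_class_1 f \<longleftrightarrow>
    (\<exists>g :: nat \<Rightarrow> 'a \<Rightarrow> real. (\<forall>n. continuous_on UNIV (g n)) \<and> (\<forall>x. (\<lambda>n. g n x) \<longlonglongrightarrow> f x))"

definition usc :: "('a::topological_space \<Rightarrow> real) \<Rightarrow> bool" where
  "usc g \<longleftrightarrow> (\<forall>c. open {x. g x < c})"

text \<open>
  Sequences of length \<open>\<mu>\<close> are functions on all of \<^typ>\<open>ordinal\<close>.  For sequences of closed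
  sets the values from \<open>\<mu>\<close> on are required to be empty; for sequences of functions
  the values from \<open>\<mu>\<close> on are irrelevant.
\<close>

definition closed_sequence :: "ordinal \<Rightarrow> (ordinal \<Rightarrow> 'a::topological_space set) \<Rightarrow> bool" where
  "closed_sequence \<mu> F \<longleftrightarrow>
     \<mu> < omega1 \<and>
     (\<forall>\<eta><\<mu>. closed (F \<eta>)) \<and>
     (\<forall>\<zeta> \<eta>. \<zeta> \<le> \<eta> \<and> \<eta> < \<mu> \<longrightarrow> F \<eta> \<subseteq> F \<zeta>) \<and>
     (\<forall>\<theta><\<mu>. is_limit \<theta> \<longrightarrow> F \<theta> = (\<Inter>\<eta>\<in>{..<\<theta>}. F \<eta>)) \<and>
     F 0 = UNIV \<and>
     (is_limit \<mu> \<longrightarrow> (\<Inter>\<eta>\<in>{..<\<mu>}. F \<eta>) = {}) \<and>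
     (\<forall>\<eta>\<ge>\<mu>. F \<eta> = {})"

definition transfinite_difference :: "ordinal \<Rightarrow> (ordinal \<Rightarrow> 'a set) \<Rightarrow> 'a set" where
  "transfinite_difference \<mu> F = (\<Union>\<eta>\<in>{\<eta>. \<eta> < \<mu> \<and> even_ord \<eta>}. F \<eta> - F (osucc \<eta>))"

definition separated_by_length :: "'a::topological_space set \<Rightarrow> 'a set \<Rightarrow> ordinal \<Rightarrow> bool" where
  "separated_by_length A B \<mu> \<longleftrightarrow>
     (\<exists>F. closed_sequence \<mu> F \<and> A \<subseteq> transfinite_difference \<mu> F \<and>
          transfinite_difference \<mu> F \<subseteq> UNIV - B)"

definition alpha1_sep :: "'a::topological_space set \<Rightarrow> 'a set \<Rightarrow> ordinal" where
  "alpha1_sep A B =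
     (if \<exists>\<mu>. separated_by_length A B \<mu> then (LEAST \<mu>. separated_by_length A B \<mu>) else omega1)"

definition alpha1 :: "('a::topological_space \<Rightarrow> real) \<Rightarrow> ordinal" where
  "alpha1 f = (SUP (p, q)\<in>{(p, q). p \<in> \<rat> \<and> q \<in> \<rat> \<and> p < q}. alpha1_sep {x. f x \<le> p} {x. f x \<ge> q})"

definition bounded_baire1 :: "ordinal \<Rightarrow> ('a::topological_space \<Rightarrow> real) set" where
  "bounded_baire1 \<Lambda> =
     {f. bounded (range f) \<and> baire_class_1 f \<and> alpha1 f \<le> omega_pow \<Lambda>}"

definition DUSB1 :: "(ordinal \<times> (ordinal \<Rightarrow> 'a::topological_space \<Rightarrow> real)) set" where
  "DUSB1 = {(\<mu>, f).
     \<mu> < omega1 \<and>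
     (\<forall>\<eta><\<mu>. usc (f \<eta>) \<and> bounded (range (f \<eta>)) \<and> (\<forall>x. 0 \<le> f \<eta> x)) \<and>
     (\<forall>\<zeta> \<eta>. \<zeta> \<le> \<eta> \<and> \<eta> < \<mu> \<longrightarrow> (\<forall>x. f \<eta> x \<le> f \<zeta> x)) \<and>
     (is_limit \<mu> \<longrightarrow> (\<forall>x. \<forall>\<epsilon>>0. \<exists>\<zeta><\<mu>. \<forall>\<eta>. \<zeta> \<le> \<eta> \<and> \<eta> < \<mu> \<longrightarrow> \<bar>f \<eta> x\<bar> < \<epsilon>))}"

text \<open>\<open>alt_sum f \<theta>\<close> is the alternating sum of the terms \<open>f \<eta>\<close> with \<open>\<eta> < \<theta>\<close>.\<close>

function alt_sum :: "(ordinal \<Rightarrow> 'a \<Rightarrow> real) \<Rightarrow> ordinal \<Rightarrow> 'a \<Rightarrow> real" where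
  "alt_sum f 0 = (\<lambda>x. 0)"
| "alt_sum f (osucc \<theta>) = (\<lambda>x. alt_sum f \<theta> x + ord_sign \<theta> * f \<theta> x)"
| "is_limit \<theta> \<Longrightarrow> alt_sum f \<theta> = (\<lambda>x. SUP \<zeta>\<in>{\<zeta>. \<zeta> < \<theta> \<and> even_ord \<zeta>}. alt_sum f \<zeta> x)"
proof -
  fix P :: bool and p :: "(ordinal \<Rightarrow> 'a \<Rightarrow> real) \<times> ordinal"
  assume "\<And>a. p = (a, 0) \<Longrightarrow> P" "\<And>a b. p = (a, osucc b) \<Longrightarrow> P"
    "\<And>b a. is_limit b \<Longrightarrow> p = (a, b) \<Longrightarrow> P"
  then show P by (rule ordinal_pair_cases)
qed auto
termination
  by (relation "inv_image {(b, b'). b < b'} snd") (auto simp: wf)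

definition alt_sum_representation :: "('a::topological_space \<Rightarrow> real) \<Rightarrow> ordinal \<Rightarrow> bool" where
  "alt_sum_representation f \<mu> \<longleftrightarrow>
     (\<exists>g c. (\<mu>, g) \<in> DUSB1 \<and> f = (\<lambda>x. c + alt_sum g \<mu> x))"

definition length1 :: "('a::topological_space \<Rightarrow> real) \<Rightarrow> ordinal" where
  "length1 f =
     (if \<exists>\<mu>. alt_sum_representation f \<mu> then (LEAST \<mu>. alt_sum_representation f \<mu>) else omega1)"

end

theory Submission
  imports Defs
begin

text \<open>
  A closed sequence of length \<open>\<mu>\<close> is the same thing as an upper semicontinuous map into the ordinals
  below \<open>\<mu>\<close>, and its transfinite difference is the set where this rank is even.  Both sides of the
  equivalence are shown to say that for every \<open>\<epsilon> > 0\<close> there is such a rank below \<open>\<omega>\<^sup>\<Lambda>\<close> on whose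
  level sets \<open>f\<close> has local oscillation less than \<open>\<epsilon>\<close>.  Ranks are combined by natural sums,
  under which \<open>\<omega>\<^sup>\<Lambda>\<close> is closed; hence these functions form a vector space.

  Separating finitely many pairs of level sets of \<open>f\<close> and adding the ranks gives a rank of small
  oscillation; conversely, doubling a rank of small oscillation and adding a parity bit separates.

  For an alternating sum, ranks of the partial sums up to \<open>\<theta> + \<omega>\<^sup>\<kappa>\<close> are built by induction
  on \<open>\<kappa>\<close>: on the closed set where the terms stay above \<open>j \<epsilon>\<close>, the tail of the sum after the first
  term below \<open>(j + 1) \<epsilon>\<close> varies by at most \<open>\<epsilon>\<close>.  Since the terms tend to \<open>0\<close>, only \<open>j = 0\<close> matters
  in the last step, so the bound there is \<open>\<omega>\<^sup>\<Lambda>\<close> itself.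

  In the other direction, if \<open>0 \<le> f \<le> M\<close>, then subtracting \<open>M / 3\<close> on a transfinite difference that
  separates \<open>{f \<ge> 2 M / 3}\<close> from \<open>{f \<le> M / 3}\<close> leaves a function between \<open>0\<close> and \<open>2 M / 3\<close>.  Iterating,
  \<open>f\<close> is a series of multiples \<open>c\<^sub>k\<close> of indicators of sets where a rank \<open>\<sigma>\<^sub>k\<close> is even, and
  \<open>f\<^sub>\<eta> = \<Sum>\<^sub>k c\<^sub>k [\<eta> \<le> \<sigma>\<^sub>k]\<close> is the required sequence.
\<close>

subsection \<open>Ordinal arithmetic\<close>

context
  includes cardinal_syntax
begin

text \<open>Proper initial segments have cardinality at most \<open>\<aleph>\<^sub>1\<close>, and
  families of that size are bounded. Hence the suprema in the limit clauses of \<open>oplus\<close>,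
  \<open>otimes\<close> and \<open>omega_pow\<close> are genuine ones.\<close>

lemma bdd_above_image_lessThan_ordinal: "bdd_above ((g :: ordinal \<Rightarrow> ordinal) ` {..<b})"
proof (rule ordinal_bdd_above)
  let ?s = "cardSuc natLeq"
  have Cs: "Card_order ?s"
    by (intro cardSuc_Card_order natLeq_Card_order)
  have "Rep_ordinal ` {..<b} \<subseteq> underS (cardSuc ?s) (Rep_ordinal b)"
    by (auto simp: underS_def less_le less_eq_ordinal_def Rep_ordinal_inject)
  then have "|Rep_ordinal ` {..<b}| \<le>o |underS (cardSuc ?s) (Rep_ordinal b)|"
    by (rule card_of_mono1)
  moreover have "|underS (cardSuc ?s) (Rep_ordinal b)| <o cardSuc ?s"
    by (rule card_of_underS[OF cardSuc_Card_order[OF Cs] Rep_ordinal])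
  ultimately have "|Rep_ordinal ` {..<b}| <o cardSuc ?s"
    by (rule ordLeq_ordLess_trans)
  moreover have "|{..<b}| =o |Rep_ordinal ` {..<b}|"
    by (rule card_of_ordIsoI[OF inj_on_imp_bij_betw]) (simp add: inj_on_def Rep_ordinal_inject)
  ultimately have "|{..<b}| <o cardSuc ?s"
    by (rule ordIso_ordLess_trans[rotated])
  then have "|{..<b}| \<le>o ?s"
    by (simp add: cardSuc_ordLeq_ordLess[OF Cs card_of_Card_order])
  then show "|g ` {..<b}| \<le>o ?s"
    using card_of_image ordLeq_transitive by blast
qed

end

lemma is_limit_osucc: "is_limit a \<Longrightarrow> b < a \<Longrightarrow> osucc b < a"
  by (simp add: is_limit_def)

lemma not_less_zero_ordinal [simp]: "\<not> a < (0 :: ordinal)"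
  by (simp add: not_less)

lemma is_limit_pos: "is_limit a \<Longrightarrow> 0 < a"
  by (metis is_limit_def order_le_less ordinal_zero_le)

lemma is_limitI: "(\<exists>b. b < a) \<Longrightarrow> (\<And>b. b < a \<Longrightarrow> \<exists>c. b < c \<and> c < a) \<Longrightarrow> is_limit a"
  unfolding is_limit_def
  by (metis leD osucc_le_iff order_le_less_trans ordinal_zero_le)

lemma even_ord_zero [simp]: "even_ord 0"
  unfolding even_ord_def by (intro exI[of _ 0] exI[of _ "0::nat"]) simp

lemma even_ord_limit: "is_limit a \<Longrightarrow> even_ord a"
  unfolding even_ord_def by (intro exI[of _ a] exI[of _ "0::nat"]) simp

lemma even_ord_osucc [simp]: "even_ord (osucc a) \<longleftrightarrow> \<not> even_ord a"
proof
  assume e: "even_ord (osucc a)"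
  then obtain b n where b: "b = 0 \<or> is_limit b" "even n" "osucc a = (osucc ^^ n) b"
    unfolding even_ord_def by blast
  then obtain k where k: "n = Suc k"
    using not_is_limit_osucc osucc_neq_zero by (cases n) auto
  then have "odd_ord a"
    unfolding odd_ord_def using b by (intro exI[of _ b] exI[of _ k]) auto
  then show "\<not> even_ord a"
    by (simp add: odd_ord_iff)
next
  assume "\<not> even_ord a"
  then obtain b n where b: "b = 0 \<or> is_limit b" "odd n" "a = (osucc ^^ n) b"
    using odd_ord_iff odd_ord_def by blast
  then show "even_ord (osucc a)"
    unfolding even_ord_def by (intro exI[of _ b] exI[of _ "Suc n"]) auto
qed

section \<open>Ordinal addition: monotonicity, associativity, decomposition below a sum\<close>

lemma less_SUP_limit_iff:
  "is_limit b \<Longrightarrow> z < (SUP c\<in>{..<b}. g c) \<longleftrightarrow> (\<exists>c<b. z < (g c :: ordinal))"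
  by (subst less_cSUP_iff) (auto simp: bdd_above_image_lessThan_ordinal dest: is_limit_pos)

lemma less_oplus_limit_iff:
  "is_limit b \<Longrightarrow> z < oplus a b \<longleftrightarrow> (\<exists>c<b. z < oplus a c)"
  by (simp add: less_SUP_limit_iff)

lemma oplus_strict_mono: "b < c \<Longrightarrow> oplus a b < oplus a c"
proof (induction c rule: less_induct)
  case (less c)
  show ?case
  proof (cases c rule: ordinal_cases)
    case zero then show ?thesis using less.prems by simp
  next
    case (succ d)
    then have "oplus a b \<le> oplus a d"
      using less by (cases "b = d") (auto simp: less_osucc_iff intro: less_imp_le)
    then show ?thesis using succ by (simp add: less_osucc_iff)
  next
    case limit
    then have "osucc b < c" using less.prems is_limit_osucc by blast
    moreover have "oplus a b < oplus a (osucc b)" by simp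
    ultimately show ?thesis using limit less_oplus_limit_iff by blast
  qed
qed

lemma oplus_less_iff [simp]: "oplus a b < oplus a c \<longleftrightarrow> b < c"
  by (metis oplus_strict_mono not_less_iff_gr_or_eq)

lemma oplus_le_iff [simp]: "oplus a b \<le> oplus a c \<longleftrightarrow> b \<le> c"
  by (simp add: not_less[symmetric])

lemma le_oplus: "a \<le> oplus a b"
  by (metis oplus.simps(1) oplus_le_iff ordinal_zero_le)

lemma is_limit_oplus: "is_limit b \<Longrightarrow> is_limit (oplus a b)"
proof (rule is_limitI)
  assume b: "is_limit b"
  show "\<exists>z. z < oplus a b" using b is_limit_pos oplus_strict_mono by blast
  fix z assume "z < oplus a b"
  then obtain c where "c < b" "z < oplus a c" using b less_oplus_limit_iff by blast
  then show "\<exists>c. z < c \<and> c < oplus a b" using oplus_strict_mono by blast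
qed

lemma eqI_less_ordinal: "(\<And>z. z < a \<longleftrightarrow> z < b) \<Longrightarrow> a = (b :: ordinal)"
  by (meson less_irrefl linorder_less_linear)

lemma oplus_assoc: "oplus (oplus a b) c = oplus a (oplus b c)"
proof (induction c rule: less_induct)
  case (less c)
  show ?case
  proof (cases c rule: ordinal_cases)
    case limit
    show ?thesis
    proof (rule eqI_less_ordinal)
      fix z
      have "z < oplus (oplus a b) c \<longleftrightarrow> (\<exists>d<c. z < oplus a (oplus b d))"
        using less.IH less_oplus_limit_iff[OF limit] by auto
      also have "\<dots> \<longleftrightarrow> (\<exists>e<oplus b c. z < oplus a e)"
        by (metis less_oplus_limit_iff[OF limit] oplus_strict_mono order_less_trans)
      also have "\<dots> \<longleftrightarrow> z < oplus a (oplus b c)"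
        using less_oplus_limit_iff[OF is_limit_oplus[OF limit]] by blast
      finally show "z < oplus (oplus a b) c \<longleftrightarrow> z < oplus a (oplus b c)" .
    qed
  qed (use less in auto)
qed

lemma oplus_zero_left [simp]: "oplus 0 a = a"
proof (induction a rule: less_induct)
  case (less a)
  show ?case
  proof (cases a rule: ordinal_cases)
    case limit
    show ?thesis
    proof (rule eqI_less_ordinal)
      fix z show "z < oplus 0 a \<longleftrightarrow> z < a"
        using less.IH less_oplus_limit_iff[OF limit] is_limit_osucc[OF limit] osucc_greater
        by (metis order_less_trans)
    qed
  qed (use less in auto)
qed

text \<open>This replaces subtraction from the left: the witness \<open>c\<close> is what remains of
  \<open>z\<close> after \<open>a\<close>.\<close>

lemma less_oplus_cases:
  assumes "z < oplus a b"
  obtains "z < a" | c where "c < b" "z = oplus a c"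
proof -
  have "z < a \<or> (\<exists>c<b. z = oplus a c)"
    using assms
  proof (induction b rule: less_induct)
    case (less b)
    show ?case
    proof (cases b rule: ordinal_cases)
      case zero then show ?thesis using less.prems by simp
    next
      case (succ d)
      then have "z < oplus a d \<or> z = oplus a d" using less.prems by (auto simp: less_osucc_iff)
      then show ?thesis using less.IH[of d] succ osucc_greater order_less_trans by blast
    next
      case limit
      then obtain c where "c < b" "z < oplus a c" using less.prems less_oplus_limit_iff by blast
      then show ?thesis using less.IH order_less_trans by blast
    qed
  qed
  then show thesis using that by blast
qed

section \<open>Finite ordinals, \<open>omega\<close> and \<open>omega1\<close>\<close>

lemma finite_ordinal_less: "is_limit a \<Longrightarrow> b < a \<Longrightarrow> (osucc ^^ n) b < a"
  by (induction n) (auto intro: is_limit_osucc)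

lemma osucc_funpow_less_iff [simp]: "(osucc ^^ m) b < (osucc ^^ n) b \<longleftrightarrow> m < n"
proof -
  have "strict_mono (\<lambda>n. (osucc ^^ n) b)" by (intro strict_monoI_Suc) simp
  then show ?thesis by (rule strict_mono_less)
qed

lemma is_limit_omega1: "is_limit omega1"
proof (rule is_limitI)
  show "\<exists>b. b < omega1"
    using less_omega1_iff[of 0] by (intro exI[of _ 0]) (simp add: lessThan_def)
  fix b assume "b < omega1"
  moreover have "{..<osucc b} = insert b {..<b}" by (auto simp: less_osucc_iff)
  ultimately have "osucc b < omega1" using less_omega1_iff by simp
  then show "\<exists>c. b < c \<and> c < omega1" using osucc_greater by blast
qed

lemma is_limit_omega: "is_limit omega"
  unfolding omega_def using is_limit_omega1 by (rule LeastI)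

lemma less_omega_iff: "a < omega \<longleftrightarrow> (\<exists>n. a = (osucc ^^ n) 0)"
proof
  assume "a < omega"
  then show "\<exists>n. a = (osucc ^^ n) 0"
  proof (induction a rule: less_induct)
    case (less a)
    show ?case
    proof (cases a rule: ordinal_cases)
      case zero then show ?thesis by (intro exI[of _ "0::nat"]) simp
    next
      case (succ b)
      then obtain n where "b = (osucc ^^ n) 0" 
        using less.IH[of b] less.prems osucc_greater order_less_trans by blast
      then show ?thesis using succ by (intro exI[of _ "Suc n"]) simp
    next
      case limit
      then show ?thesis using less.prems not_less_Least unfolding omega_def by blast
    qed
  qed
next
  assume "\<exists>n. a = (osucc ^^ n) 0"
  then show "a < omega" using finite_ordinal_less[OF is_limit_omega is_limit_pos[OF is_limit_omega]] by blast
qed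

lemma omega_less_omega1: "omega < omega1"
proof -
  have "{..<omega} \<subseteq> range (\<lambda>n. (osucc ^^ n) 0)" by (auto simp: less_omega_iff)
  then show ?thesis unfolding less_omega1_iff by (rule countable_subset) simp
qed

text \<open>The initial segment below the supremum is a countable union of countable initial
  segments.\<close>

lemma SUP_less_omega1:
  assumes "b < omega1" "is_limit b" "\<And>c. c < b \<Longrightarrow> g c < omega1"
  shows "(SUP c\<in>{..<b}. g c) < omega1"
proof -
  have "{..<(SUP c\<in>{..<b}. g c)} \<subseteq> (\<Union>c\<in>{..<b}. {..<g c})"
    using less_SUP_limit_iff[OF assms(2)] by auto
  then show ?thesis
    unfolding less_omega1_iff by (rule countable_subset) (use assms less_omega1_iff in auto)
qed

lemma less_omega1_induct [consumes 1, case_names zero succ limit]: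
  assumes "b < omega1" "P 0" "\<And>b. P b \<Longrightarrow> P (osucc b)"
    and "\<And>b. is_limit b \<Longrightarrow> b < omega1 \<Longrightarrow> (\<And>c. c < b \<Longrightarrow> P c) \<Longrightarrow> P b"
  shows "P b"
  using assms(1)
proof (induction b rule: less_induct)
  case (less b)
  have "P c" if "c < b" for c
    using less that order_less_trans by blast
  then show ?case
    by (cases b rule: ordinal_cases) (use assms(2-4) less.prems in auto)
qed

lemma oplus_less_omega1: "b < omega1 \<Longrightarrow> a < omega1 \<Longrightarrow> oplus a b < omega1"
  by (induction rule: less_omega1_induct)
    (simp_all add: is_limit_osucc[OF is_limit_omega1] SUP_less_omega1)

lemma otimes_less_omega1: "b < omega1 \<Longrightarrow> a < omega1 \<Longrightarrow> otimes a b < omega1"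
  by (induction rule: less_omega1_induct)
    (simp_all add: is_limit_pos[OF is_limit_omega1] SUP_less_omega1 oplus_less_omega1)

lemma omega_pow_less_omega1: "b < omega1 \<Longrightarrow> omega_pow b < omega1"
  by (induction rule: less_omega1_induct)
    (simp_all add: one_ordinal_eq is_limit_osucc[OF is_limit_omega1] is_limit_pos[OF is_limit_omega1]
      SUP_less_omega1 otimes_less_omega1 omega_less_omega1)

section \<open>Finite multiples and powers of \<open>omega\<close>\<close>

primrec nat_mult :: "nat \<Rightarrow> ordinal \<Rightarrow> ordinal" where
  "nat_mult 0 a = 0"
| "nat_mult (Suc n) a = oplus (nat_mult n a) a"

lemma otimes_finite: "otimes a ((osucc ^^ n) 0) = nat_mult n a"
  by (induction n) simp_all

lemma less_omega_pow_osucc_iff: "z < omega_pow (osucc b) \<longleftrightarrow> (\<exists>n. z < nat_mult n (omega_pow b))"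
  by (auto simp: is_limit_omega less_SUP_limit_iff less_omega_iff otimes_finite[symmetric])

lemma less_omega_pow_limit_iff:
  "is_limit b \<Longrightarrow> z < omega_pow b \<longleftrightarrow> (\<exists>c<b. z < omega_pow c)"
  by (simp add: less_SUP_limit_iff)

lemma omega_pow_pos: "0 < omega_pow b"
proof (induction b rule: less_induct)
  case (less b)
  show ?case
  proof (cases b rule: ordinal_cases)
    case (succ c)
    then have "0 < nat_mult 1 (omega_pow c)" using less by simp
    then show ?thesis using succ less_omega_pow_osucc_iff by blast
  next
    case limit
    then show ?thesis using less less_omega_pow_limit_iff is_limit_pos by blast
  qed (simp add: one_ordinal_eq)
qed

lemma omega_pow_less_osucc: "omega_pow b < omega_pow (osucc b)"
proof -
  have "omega_pow b < nat_mult 2 (omega_pow b)"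
    using omega_pow_pos oplus_strict_mono[of 0 "omega_pow b" "omega_pow b"] 
    by (simp add: numeral_2_eq_2)
  then show ?thesis using less_omega_pow_osucc_iff by blast
qed

lemma omega_pow_strict_mono: "b < c \<Longrightarrow> omega_pow b < omega_pow c"
proof (induction c rule: less_induct)
  case (less c)
  show ?case
  proof (cases c rule: ordinal_cases)
    case zero then show ?thesis using less.prems by simp
  next
    case (succ d)
    then have "omega_pow b \<le> omega_pow d"
      using less by (cases "b = d") (auto simp: less_osucc_iff intro: less_imp_le)
    also have "\<dots> < omega_pow c" using succ omega_pow_less_osucc by blast
    finally show ?thesis .
  next
    case limit
    then have "osucc b < c" using less.prems is_limit_osucc by blast
    then show ?thesis using limit less_omega_pow_limit_iff omega_pow_less_osucc by blast
  qed
qed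

lemma omega_pow_mono: "b \<le> c \<Longrightarrow> omega_pow b \<le> omega_pow c"
  using omega_pow_strict_mono by (auto simp: le_less)

lemma is_limit_omega_pow: 
  assumes "0 < b" shows "is_limit (omega_pow b)"
  using assms
proof (induction b rule: less_induct)
  case (less b)
  show ?case
  proof (cases b rule: ordinal_cases)
    case (succ c)
    show ?thesis
    proof (rule is_limitI)
      fix z assume "z < omega_pow b"
      then obtain n where n: "z < nat_mult n (omega_pow c)" using succ less_omega_pow_osucc_iff by blast
      have "nat_mult n (omega_pow c) < nat_mult (Suc n) (omega_pow c)" 
        using oplus_strict_mono[OF omega_pow_pos, of "nat_mult n (omega_pow c)"] by simp
      then show "\<exists>d. z < d \<and> d < omega_pow b" using n succ less_omega_pow_osucc_iff by blast
    qed (use omega_pow_pos in blast)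
  next
    case limit
    show ?thesis
    proof (rule is_limitI)
      fix z assume "z < omega_pow b"
      then show "\<exists>d. z < d \<and> d < omega_pow b" 
        using less_omega_pow_limit_iff[OF limit] is_limit_osucc[OF limit] omega_pow_strict_mono by blast
    qed (use omega_pow_pos in blast)
  qed (use less in simp)
qed

text \<open>Division with remainder by \<open>a\<close>.\<close>

lemma less_nat_mult_cases:
  assumes "z < nat_mult n a"
  obtains m r where "m < n" "r < a" "z = oplus (nat_mult m a) r"
proof -
  have "\<exists>m r. m < n \<and> r < a \<and> z = oplus (nat_mult m a) r"
    using assms
  proof (induction n)
    case (Suc n)
    then have "z < oplus (nat_mult n a) a" by simp
    then show ?case
      by (rule less_oplus_cases) (use Suc.IH less_Suc_eq in blast)+
  qed simp
  then show thesis using that by blast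
qed

lemma nat_mult_mono: "m \<le> n \<Longrightarrow> nat_mult m a \<le> nat_mult n a"
  by (rule lift_Suc_mono_le[of "\<lambda>n. nat_mult n a"]) (simp_all add: le_oplus)


subsection \<open>Natural sums\<close>

text \<open>The Hessenberg natural sum, in recursive form instead of by Cantor normal forms; this
  form builds in strict monotonicity in each argument.\<close>

function nsum :: "ordinal \<Rightarrow> ordinal \<Rightarrow> ordinal" where
  "nsum a b = (LEAST c. (\<forall>d\<in>{..<a}. nsum d b < c) \<and> (\<forall>d\<in>{..<b}. nsum a d < c))"
  by pat_completeness auto
termination
  by (relation "{(b, b'). b < b'} <*lex*> {(b, b'). b < b'}") (auto simp: wf)

declare nsum.simps [simp del]

text \<open>Candidates for the defining minimum exist because the earlier sums are indexed by
  initial segments and are therefore bounded.\<close>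

lemma nsum_less: "(\<forall>d<a. nsum d b < nsum a b) \<and> (\<forall>d<b. nsum a d < nsum a b)"
proof -
  obtain u v where "\<And>d. d < a \<Longrightarrow> nsum d b \<le> u" "\<And>d. d < b \<Longrightarrow> nsum a d \<le> v"
    using bdd_above_image_lessThan_ordinal[of "\<lambda>d. nsum d b" a]
      bdd_above_image_lessThan_ordinal[of "\<lambda>d. nsum a d" b]
    unfolding bdd_above_def by fastforce
  then have "(\<forall>d\<in>{..<a}. nsum d b < osucc (max u v)) \<and> (\<forall>d\<in>{..<b}. nsum a d < osucc (max u v))"
    by (auto simp: less_osucc_iff le_max_iff_disj)
  then have "(\<forall>d\<in>{..<a}. nsum d b < nsum a b) \<and> (\<forall>d\<in>{..<b}. nsum a d < nsum a b)"
    unfolding nsum.simps[of a b] by (rule LeastI)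
  then show ?thesis by auto
qed

lemma nsum_strict_mono_left: "a < a' \<Longrightarrow> nsum a b < nsum a' b"
  using nsum_less by blast

lemma nsum_strict_mono_right: "b < b' \<Longrightarrow> nsum a b < nsum a b'"
  using nsum_less by blast

lemma nsum_mono: "a \<le> a' \<Longrightarrow> b \<le> b' \<Longrightarrow> nsum a b \<le> nsum a' b'"
  by (metis nsum_strict_mono_left nsum_strict_mono_right order.order_iff_strict order.trans)

lemma nsum_strict_mono: "a < a' \<Longrightarrow> b < b' \<Longrightarrow> nsum a b < nsum a' b'"
  using nsum_strict_mono_left nsum_strict_mono_right order_less_trans by blast

text \<open>Reason for using natural sums: if two ranks can only drop near a point and their sum
  stays the same, then neither has dropped. Ordinary addition fails here, since it is not strictly
  increasing on the left.\<close>

lemma nsum_eqD: "nsum a b = nsum a' b' \<Longrightarrow> a \<le> a' \<Longrightarrow> b \<le> b' \<Longrightarrow> a = a' \<and> b = b'"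
  by (metis nsum_mono nsum_strict_mono_left nsum_strict_mono_right order.order_iff_strict
      order_less_le_trans less_irrefl)

lemma nsum_leI:
  assumes "\<And>d. d < a \<Longrightarrow> nsum d b < c" "\<And>d. d < b \<Longrightarrow> nsum a d < c"
  shows "nsum a b \<le> c"
  unfolding nsum.simps[of a b] using assms by (auto intro: Least_le)

lemma nsum_zero [simp]: "nsum 0 0 = 0"
proof -
  have "nsum 0 0 \<le> 0" by (rule nsum_leI) auto
  then show ?thesis by (metis ordinal_zero_le order_antisym)
qed

text \<open>An ordinal below \<open>oplus a b\<close> is below \<open>a\<close> or equals
  \<open>oplus a c\<close> with \<open>c < b\<close>; strict monotonicity keeps
  \<open>nsum a b\<close> from being either. Bounds on natural sums thereby carry over to ordinary
  sums.\<close>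

lemma oplus_le_nsum: "oplus a b \<le> nsum a b"
proof (induction b rule: less_induct)
  case (less b)
  show ?case
  proof (rule ccontr)
    assume "\<not> oplus a b \<le> nsum a b"
    then have n: "nsum a b < oplus a b" by simp
    then show False
    proof (rule less_oplus_cases)
      assume "nsum a b < a"
      moreover have "a \<le> nsum a b" for a
      proof (induction a rule: less_induct)
        case (less a)
        then show ?case
          using nsum_strict_mono_left[of _ a b] by (meson leI order_le_less_trans less_irrefl)
      qed
      ultimately show False by (simp add: not_less[symmetric])
    next
      fix c assume c: "c < b" "nsum a b = oplus a c"
      then have "nsum a b \<le> nsum a c" using less by simp
      then show False using nsum_strict_mono_right[OF c(1), of a] by simp
    qed
  qed
qed

text \<open>Coefficients of \<open>w\<close> add up and remainders combine by \<open>nsum\<close>.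
  Closure of \<open>w\<close> under \<open>nsum\<close> ensures that a smaller coefficient outweighs
  any remainder.\<close>

lemma nsum_nat_mult_le:
  assumes closed: "\<And>a b. a < w \<Longrightarrow> b < w \<Longrightarrow> nsum a b < w" and "r < w" "s < w"
  shows "nsum (oplus (nat_mult m w) r) (oplus (nat_mult n w) s)
    \<le> oplus (nat_mult (m + n) w) (nsum r s)"
proof -
  \<comment> \<open>The induction follows the recursion of \<open>nsum\<close>; the decompositions
    are quantified inside because smaller arguments have other coefficients and remainders.\<close>
  have *: "\<forall>m r n s. a = oplus (nat_mult m w) r \<longrightarrow> b = oplus (nat_mult n w) s \<longrightarrow> r < w \<longrightarrow> s < w \<longrightarrow>
      nsum a b \<le> oplus (nat_mult (m + n) w) (nsum r s)" for a b
  proof (induction a b rule: nsum.induct)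
    case (1 a b)
    show ?case
    proof (intro allI impI)
      fix m r n s assume a: "a = oplus (nat_mult m w) r" and b: "b = oplus (nat_mult n w) s"
        and rs: "r < w" "s < w"
      have less_next: "oplus (nat_mult k w) t < oplus (nat_mult k' w) t'" if "k < k'" "t < w" for k k' t t'
      proof -
        have "oplus (nat_mult k w) t < nat_mult (Suc k) w" using that by simp
        also have "\<dots> \<le> nat_mult k' w" using that nat_mult_mono Suc_leI by blast
        also have "\<dots> \<le> oplus (nat_mult k' w) t'" by (rule le_oplus)
        finally show ?thesis .
      qed
      \<comment> \<open>Smaller ordinals have lexicographically smaller pairs of coefficient and
        remainder.\<close>
      have smaller: "\<exists>k t. c = oplus (nat_mult k w) t \<and> t < w \<and> (k < m \<or> k = m \<and> t < r)"
        if "c < oplus (nat_mult m w) r" "r < w" for c m r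
      proof -
        have "c < nat_mult (Suc m) w"
          using that order_less_trans by fastforce
        then obtain k t where kt: "k < Suc m" "t < w" "c = oplus (nat_mult k w) t"
          by (rule less_nat_mult_cases)
        then show ?thesis using that less_Suc_eq oplus_less_iff by metis
      qed
      show "nsum a b \<le> oplus (nat_mult (m + n) w) (nsum r s)"
      proof (rule nsum_leI)
        fix d assume d: "d < a"
        then obtain k t where kt: "d = oplus (nat_mult k w) t" "t < w" "k < m \<or> k = m \<and> t < r"
          using smaller a rs by blast
        have "nsum d b \<le> oplus (nat_mult (k + n) w) (nsum t s)"
          using "1.IH"(1) d kt b rs by blast
        also have "\<dots> < oplus (nat_mult (m + n) w) (nsum r s)"
          using kt rs closed by (auto intro: less_next nsum_strict_mono_left)
        finally show "nsum d b < oplus (nat_mult (m + n) w) (nsum r s)" .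
      next
        fix d assume d: "d < b"
        then obtain k t where kt: "d = oplus (nat_mult k w) t" "t < w" "k < n \<or> k = n \<and> t < s"
          using smaller b rs by blast
        have "nsum a d \<le> oplus (nat_mult (m + k) w) (nsum r t)"
          using "1.IH"(2) d kt a rs by blast
        also have "\<dots> < oplus (nat_mult (m + n) w) (nsum r s)"
          using kt rs closed by (auto intro: less_next nsum_strict_mono_right)
        finally show "nsum a d < oplus (nat_mult (m + n) w) (nsum r s)" .
      qed
    qed
  qed
  then show ?thesis using assms(2,3) by blast
qed

text \<open>Powers of \<open>omega\<close> are indecomposable even for natural sums. At a successor
  exponent both arguments are divided by the previous power, and the sum stays below the next finite
  multiple.\<close>

lemma nsum_less_omega_pow: "a < omega_pow c \<Longrightarrow> b < omega_pow c \<Longrightarrow> nsum a b < omega_pow c"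
proof (induction c arbitrary: a b rule: less_induct)
  case (less c)
  show ?case
  proof (cases c rule: ordinal_cases)
    case zero
    then show ?thesis using less.prems nsum_mono[of a 0 b 0] by (simp add: one_ordinal_eq less_osucc_iff)
  next
    case (succ d)
    define w where "w = omega_pow d"
    have closed: "nsum a b < w" if "a < w" "b < w" for a b
      using less.IH[of d a b] that succ by (simp add: w_def)
    obtain m n where "a < nat_mult m w" "b < nat_mult n w"
      using less.prems succ less_omega_pow_osucc_iff w_def by blast
    then obtain k r l s where a: "r < w" "a = oplus (nat_mult k w) r" and b: "s < w" "b = oplus (nat_mult l w) s"
      by (meson less_nat_mult_cases)
    have "nsum a b \<le> oplus (nat_mult (k + l) w) (nsum r s)"
      unfolding a(2) b(2) by (rule nsum_nat_mult_le[OF closed a(1) b(1)])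
    also have "\<dots> < nat_mult (Suc (k + l)) w"
      using closed a b by simp
    finally show ?thesis using succ less_omega_pow_osucc_iff w_def by blast
  next
    case limit
    then obtain i j where "i < c" "a < omega_pow i" "j < c" "b < omega_pow j"
      using less.prems less_omega_pow_limit_iff by blast
    then have "max i j < c" "a < omega_pow (max i j)" "b < omega_pow (max i j)"
      using omega_pow_mono[of i "max i j"] omega_pow_mono[of j "max i j"] by (auto simp: less_le_trans)
    then have "nsum a b < omega_pow (max i j)" using less.IH by blast
    then show ?thesis using \<open>max i j < c\<close> limit less_omega_pow_limit_iff by blast
  qed
qed

lemma oplus_less_omega_pow: "a < omega_pow c \<Longrightarrow> b < omega_pow c \<Longrightarrow> oplus a b < omega_pow c"
  using nsum_less_omega_pow oplus_le_nsum order_le_less_trans by blast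

primrec nsums :: "nat \<Rightarrow> (nat \<Rightarrow> ordinal) \<Rightarrow> ordinal" where
  "nsums 0 s = 0"
| "nsums (Suc n) s = nsum (nsums n s) (s n)"

lemma nsums_mono: "(\<And>i. i < n \<Longrightarrow> s i \<le> t i) \<Longrightarrow> nsums n s \<le> nsums n t"
  by (induction n) (auto intro!: nsum_mono)

lemma nsums_eqD:
  "nsums n s = nsums n t \<Longrightarrow> (\<And>i. i < n \<Longrightarrow> s i \<le> t i) \<Longrightarrow> i < n \<Longrightarrow> s i = t i"
proof (induction n)
  case (Suc n)
  have "nsums n s = nsums n t \<and> s n = t n"
    using Suc.prems by (intro nsum_eqD) (auto intro!: nsums_mono)
  then show ?case using Suc less_Suc_eq by metis
qed simp

lemma nsums_less_omega_pow:
  "(\<And>i. i < n \<Longrightarrow> s i < omega_pow c) \<Longrightarrow> nsums n s < omega_pow c"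
  by (induction n) (auto intro!: nsum_less_omega_pow omega_pow_pos)

text \<open>Since the values are even and \<open>osucc (double a) < double b\<close> for \<open>a < b\<close>, there is room for a
  parity bit.\<close>

function double :: "ordinal \<Rightarrow> ordinal" where
  "double 0 = 0"
| "double (osucc b) = osucc (osucc (double b))"
| "is_limit b \<Longrightarrow> double b = b"
proof -
  fix P :: bool and p :: "ordinal"
  assume "p = 0 \<Longrightarrow> P" "\<And>b. p = osucc b \<Longrightarrow> P"
    "\<And>b. is_limit b \<Longrightarrow> p = b \<Longrightarrow> P"
  then show P by (rule ordinal_limit_cases)
qed auto
termination
  by (relation "{(b, b'). b < b'}") (auto simp: wf)

lemma even_ord_double: "even_ord (double a)"
proof (induction a rule: less_induct)
  case (less a)
  then show ?case by (cases a rule: ordinal_cases) (auto simp: even_ord_limit)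
qed

lemma double_less_limit: "is_limit c \<Longrightarrow> a < c \<Longrightarrow> double a < c"
proof (induction a rule: less_induct)
  case (less a)
  show ?case
  proof (cases a rule: ordinal_cases)
    case (succ b)
    then have "b < c" using less.prems osucc_greater order_less_trans by blast
    then have "double b < c" using less succ by simp
    then show ?thesis using succ less.prems by (simp add: is_limit_osucc)
  qed (use less in simp_all)
qed

lemma osucc_double_less: "a < b \<Longrightarrow> osucc (double a) < double b"
proof (induction b rule: less_induct)
  case (less b)
  show ?case
  proof (cases b rule: ordinal_cases)
    case zero then show ?thesis using less.prems by simp
  next
    case (succ d)
    then have "double a \<le> double d"
    proof (cases "a = d")
      case False
      then have "osucc (double a) < double d" using less succ by (simp add: less_osucc_iff)
      then show ?thesis using osucc_greater order_less_trans less_imp_le by blast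
    qed simp
    then show ?thesis using succ by (simp add: less_osucc_iff osucc_le_iff)
  next
    case limit
    then show ?thesis using less.prems double_less_limit is_limit_osucc by simp
  qed
qed

subsection \<open>Semicontinuous ordinal ranks\<close>

text \<open>A decreasing continuous sequence \<open>F\<close> of closed sets is encoded by the map sending \<open>x\<close> to the
  last \<open>\<eta>\<close> with \<open>x \<in> F \<eta>\<close>.\<close>

definition usc_rank :: "('a::topological_space \<Rightarrow> ordinal) \<Rightarrow> bool" where
  "usc_rank \<rho> \<longleftrightarrow> (\<forall>x. \<forall>\<^sub>F y in nhds x. \<rho> y \<le> \<rho> x)"

lemma usc_rankD: "usc_rank \<rho> \<Longrightarrow> \<forall>\<^sub>F y in nhds x. \<rho> y \<le> \<rho> x"
  by (simp add: usc_rank_def)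

lemma usc_rank_nsum: 
  assumes "usc_rank \<rho>" "usc_rank \<sigma>" shows "usc_rank (\<lambda>x. nsum (\<rho> x) (\<sigma> x))"
  unfolding usc_rank_def
proof
  fix x show "\<forall>\<^sub>F y in nhds x. nsum (\<rho> y) (\<sigma> y) \<le> nsum (\<rho> x) (\<sigma> x)"
    using usc_rankD[OF assms(1), of x] usc_rankD[OF assms(2), of x]
    by eventually_elim (rule nsum_mono)
qed

lemma eventually_all_less: 
  "(\<And>i. i < (n::nat) \<Longrightarrow> eventually (P i) F) \<Longrightarrow> eventually (\<lambda>x. \<forall>i<n. P i x) F"
  using eventually_ball_finite[of "{..<n}" "\<lambda>x i. P i x" F] by (simp add: Ball_def)

lemma usc_rank_nsums: 
  assumes "\<And>i. i < n \<Longrightarrow> usc_rank (\<rho> i)" shows "usc_rank (\<lambda>x. nsums n (\<lambda>i. \<rho> i x))"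
  unfolding usc_rank_def
proof
  fix x 
  have "\<forall>\<^sub>F y in nhds x. \<forall>i<n. \<rho> i y \<le> \<rho> i x"
    using assms by (intro eventually_all_less) (auto dest: usc_rankD)
  then show "\<forall>\<^sub>F y in nhds x. nsums n (\<lambda>i. \<rho> i y) \<le> nsums n (\<lambda>i. \<rho> i x)"
    by eventually_elim (auto intro: nsums_mono)
qed

text \<open>Near \<open>x\<close> no rank exceeds its value at \<open>x\<close>, so an unchanged sum
  leaves no room for any of them to drop.\<close>

lemma eventually_nsums_eqD: 
  assumes "\<And>i. i < n \<Longrightarrow> usc_rank (\<rho> i)"
  shows "\<forall>\<^sub>F y in nhds x. nsums n (\<lambda>i. \<rho> i y) = nsums n (\<lambda>i. \<rho> i x) \<longrightarrow> (\<forall>i<n. \<rho> i y = \<rho> i x)"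
proof -
  have "\<forall>\<^sub>F y in nhds x. \<forall>i<n. \<rho> i y \<le> \<rho> i x"
    using assms by (intro eventually_all_less) (auto dest: usc_rankD)
  then show ?thesis
    by eventually_elim (use nsums_eqD in blast)
qed

lemma closed_sequence_rank:
  assumes "closed_sequence \<mu> F"
  obtains \<sigma> where "usc_rank \<sigma>" "\<And>x. \<sigma> x < \<mu>" "transfinite_difference \<mu> F = {x. even_ord (\<sigma> x)}"
proof -
  note cs = assms[unfolded closed_sequence_def, THEN conjunct2]
  have cl: "closed (F \<eta>)" if "\<eta> < \<mu>" for \<eta>
    using cs[THEN conjunct1] that by blast
  have dec: "F \<eta> \<subseteq> F \<zeta>" if "\<zeta> \<le> \<eta>" "\<eta> < \<mu>" for \<zeta> \<eta>
    using cs[THEN conjunct2, THEN conjunct1] that by blast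
  have lim: "F \<theta> = (\<Inter>\<eta>\<in>{..<\<theta>}. F \<eta>)" if "\<theta> < \<mu>" "is_limit \<theta>" for \<theta>
    using cs[THEN conjunct2, THEN conjunct2, THEN conjunct1] that by blast
  note cs' = cs[THEN conjunct2, THEN conjunct2, THEN conjunct2]
  have F0: "F 0 = UNIV" and lim\<mu>: "is_limit \<mu> \<Longrightarrow> (\<Inter>\<eta>\<in>{..<\<mu>}. F \<eta>) = {}"
    and emp: "\<And>\<eta>. \<mu> \<le> \<eta> \<Longrightarrow> F \<eta> = {}"
    using cs' by simp_all
  have dec': "F \<eta> \<subseteq> F \<zeta>" if "\<zeta> \<le> \<eta>" for \<zeta> \<eta>
    using dec[OF that] emp[of \<eta>] by (cases "\<eta> < \<mu>") auto
  have ex: "\<exists>\<eta>. x \<in> F \<eta> \<and> x \<notin> F (osucc \<eta>) \<and> \<eta> < \<mu>" for x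
  proof -
    \<comment> \<open>The first index whose set omits \<open>x\<close> must be a successor:
      \<open>F 0 = UNIV\<close> excludes zero, and continuity, or the empty intersection at
      \<open>\<mu>\<close>, excludes limits. Its predecessor is the rank of
      \<open>x\<close>.\<close>
    define \<xi> where "\<xi> = (LEAST \<xi>. x \<notin> F \<xi>)"
    have "x \<notin> F \<mu>" using emp by simp
    then have \<xi>: "x \<notin> F \<xi>" "\<xi> \<le> \<mu>" unfolding \<xi>_def by (rule LeastI, rule Least_le)
    have below: "x \<in> F \<eta>" if "\<eta> < \<xi>" for \<eta> using that not_less_Least unfolding \<xi>_def by blast
    show ?thesis
    proof (cases \<xi> rule: ordinal_cases)
      case zero then show ?thesis using \<xi> F0 by simp
    next
      case (succ \<eta>)
      then show ?thesis using \<xi> below[of \<eta>] by (auto simp: osucc_le_iff)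
    next
      case limit
      have all: "x \<in> (\<Inter>\<eta>\<in>{..<\<xi>}. F \<eta>)" using below by blast
      show ?thesis
      proof (cases "\<xi> = \<mu>")
        case True then show ?thesis using all lim\<mu> limit by blast
      next
        case False
        then have "\<xi> < \<mu>" using \<xi>(2) by simp
        then show ?thesis using all lim[OF _ limit] \<xi>(1) by simp
      qed
    qed
  qed
  define \<sigma> where "\<sigma> x = (SOME \<eta>. x \<in> F \<eta> \<and> x \<notin> F (osucc \<eta>) \<and> \<eta> < \<mu>)" for x
  have \<sigma>: "x \<in> F (\<sigma> x)" "x \<notin> F (osucc (\<sigma> x))" "\<sigma> x < \<mu>" for x
    using someI_ex[OF ex[of x]] unfolding \<sigma>_def by auto
  have le: "\<sigma> y \<le> \<eta>" if "y \<notin> F (osucc \<eta>)" for y \<eta>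
    using that \<sigma>(1)[of y] dec' by (metis le_less_linear osucc_le_iff subsetD)
  show thesis
  proof (rule that)
    show "usc_rank \<sigma>"
      unfolding usc_rank_def
    proof
      fix x
      \<comment> \<open>The index \<open>osucc (\<sigma> x)\<close> may equal \<open>\<mu>\<close>;
        there the set is empty by convention, hence also closed.\<close>
      have "closed (F (osucc (\<sigma> x)))"
        using cl emp closed_empty by (metis not_le)
      then have "\<forall>\<^sub>F y in nhds x. y \<in> - F (osucc (\<sigma> x))"
        using \<sigma>(2) by (intro eventually_nhds_in_open) auto
      then show "\<forall>\<^sub>F y in nhds x. \<sigma> y \<le> \<sigma> x"
        by eventually_elim (use le in auto)
    qed
    show "\<sigma> x < \<mu>" for x by (rule \<sigma>)
    have "\<eta> = \<sigma> x" if "x \<in> F \<eta>" "x \<notin> F (osucc \<eta>)" for x \<eta>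
      using that le[of x \<eta>] \<sigma>(2)[of x] dec' by (metis antisym_conv1 not_le osucc_le_iff subsetD)
    then show "transfinite_difference \<mu> F = {x. even_ord (\<sigma> x)}"
      unfolding transfinite_difference_def using \<sigma> by blast
  qed
qed

text \<open>Since \<open>\<mu>\<close> is a limit, \<open>osucc (\<sigma> x)\<close> is still an
  index below it and its set omits \<open>x\<close>; this makes the total intersection
  empty.\<close>

lemma closed_sequence_of_rank:
  fixes \<sigma> :: "'a::topological_space \<Rightarrow> ordinal"
  assumes "usc_rank \<sigma>" "\<And>x. \<sigma> x < \<mu>" "is_limit \<mu>" "\<mu> < omega1"
  shows "closed_sequence \<mu> (\<lambda>\<eta>. {x. \<eta> \<le> \<sigma> x})"
    and "transfinite_difference \<mu> (\<lambda>\<eta>. {x. \<eta> \<le> \<sigma> x}) = {x. even_ord (\<sigma> x)}"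
proof -
  have "closed {x. \<eta> \<le> \<sigma> x}" for \<eta>
  proof -
    have "open {x. \<sigma> x < \<eta>}"
      unfolding open_subopen[of "{x. \<sigma> x < \<eta>}"] 
    proof safe
      fix x assume "\<sigma> x < \<eta>"
      then have "\<forall>\<^sub>F y in nhds x. \<sigma> y < \<eta>"
        by (intro eventually_mono[OF usc_rankD[OF assms(1), of x]]) simp
      then show "\<exists>T. open T \<and> x \<in> T \<and> T \<subseteq> {x. \<sigma> x < \<eta>}"
        unfolding eventually_nhds by blast
    qed
    moreover have "- {x. \<eta> \<le> \<sigma> x} = {x. \<sigma> x < \<eta>}" by auto
    ultimately show ?thesis unfolding closed_def by simp
  qed
  moreover have "{x. \<theta> \<le> \<sigma> x} = (\<Inter>\<eta>\<in>{..<\<theta>}. {x. \<eta> \<le> \<sigma> x})" if "is_limit \<theta>" for \<theta>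
  proof (intro equalityI subsetI; simp)
    fix x assume "\<forall>\<eta>\<in>{..<\<theta>}. \<eta> \<le> \<sigma> x"
    then show "\<theta> \<le> \<sigma> x"
      using is_limit_osucc[OF that, of "\<sigma> x"] osucc_greater[of "\<sigma> x"]
      by (meson lessThan_iff not_less)
  qed auto
  moreover have "(\<Inter>\<eta>\<in>{..<\<mu>}. {x. \<eta> \<le> \<sigma> x}) = {}"
  proof (intro equals0I)
    fix x assume "x \<in> (\<Inter>\<eta>\<in>{..<\<mu>}. {x. \<eta> \<le> \<sigma> x})"
    then have "osucc (\<sigma> x) \<le> \<sigma> x" using is_limit_osucc[OF assms(3) assms(2)] by blast
    then show False by (simp add: osucc_le_iff)
  qed
  moreover have "{x. \<eta> \<le> \<sigma> x} = {}" if "\<mu> \<le> \<eta>" for \<eta>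
    using assms(2) that by (auto simp: not_le intro: less_le_trans)
  ultimately show "closed_sequence \<mu> (\<lambda>\<eta>. {x. \<eta> \<le> \<sigma> x})"
    unfolding closed_sequence_def using assms(4) by auto
  have "\<eta> = \<sigma> x" if "\<eta> \<le> \<sigma> x" "\<not> osucc \<eta> \<le> \<sigma> x" for \<eta> x
    using that by (simp add: osucc_le_iff)
  then show "transfinite_difference \<mu> (\<lambda>\<eta>. {x. \<eta> \<le> \<sigma> x}) = {x. even_ord (\<sigma> x)}"
    unfolding transfinite_difference_def using assms(2) osucc_le_iff by fastforce
qed

section \<open>Separation by the parity of a rank\<close>

definition rank_separated :: "ordinal \<Rightarrow> 'a::topological_space set \<Rightarrow> 'a set \<Rightarrow> bool" where
  "rank_separated \<mu> A B \<longleftrightarrow>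
     (\<exists>\<sigma>. usc_rank \<sigma> \<and> (\<forall>x. \<sigma> x < \<mu>) \<and> (\<forall>x\<in>A. even_ord (\<sigma> x)) \<and> (\<forall>x\<in>B. \<not> even_ord (\<sigma> x)))"

lemma separated_by_length_imp_rank_separated:
  assumes "separated_by_length A B \<mu>" "\<mu> \<le> \<nu>" shows "rank_separated \<nu> A B"
proof -
  obtain F where F: "closed_sequence \<mu> F" "A \<subseteq> transfinite_difference \<mu> F" 
    "transfinite_difference \<mu> F \<subseteq> UNIV - B"
    using assms(1) unfolding separated_by_length_def by blast
  obtain \<sigma> where \<sigma>: "usc_rank \<sigma>" "\<And>x. \<sigma> x < \<mu>" "transfinite_difference \<mu> F = {x. even_ord (\<sigma> x)}"
    using closed_sequence_rank[OF F(1)] by blast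
  show ?thesis unfolding rank_separated_def
    using \<sigma> F assms(2) order_less_le_trans by (intro exI[of _ \<sigma>]) blast
qed

lemma rank_separated_iff_alpha1_sep:
  assumes "is_limit \<mu>" "\<mu> < omega1"
  shows "rank_separated \<mu> A B \<longleftrightarrow> alpha1_sep A B \<le> \<mu>"
proof
  assume "rank_separated \<mu> A B"
  then obtain \<sigma> where \<sigma>: "usc_rank \<sigma>" "\<And>x. \<sigma> x < \<mu>" "\<forall>x\<in>A. even_ord (\<sigma> x)" "\<forall>x\<in>B. \<not> even_ord (\<sigma> x)"
    unfolding rank_separated_def by blast
  have "separated_by_length A B \<mu>"
    unfolding separated_by_length_def
    using closed_sequence_of_rank[OF \<sigma>(1,2) assms] \<sigma>(3,4)
    by (intro exI[of _ "\<lambda>\<eta>. {x. \<eta> \<le> \<sigma> x}"]) auto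
  then show "alpha1_sep A B \<le> \<mu>" unfolding alpha1_sep_def by (auto intro: Least_le)
next
  assume *: "alpha1_sep A B \<le> \<mu>"
  \<comment> \<open>The default value \<open>omega1\<close> is excluded by
    \<open>\<mu> < omega1\<close>, so the minimum is attained.\<close>
  then have ex: "\<exists>\<mu>. separated_by_length A B \<mu>"
    using assms(2) unfolding alpha1_sep_def by (auto split: if_splits)
  then have "separated_by_length A B (alpha1_sep A B)"
    unfolding alpha1_sep_def by (auto intro: LeastI_ex)
  then show "rank_separated \<mu> A B" using * by (rule separated_by_length_imp_rank_separated)
qed

text \<open>Provides the upper bound that makes the supremum in \<open>alpha1\<close> a genuine
  one.\<close>

lemma alpha1_sep_le_omega1: "alpha1_sep A B \<le> omega1"
proof (cases "\<exists>\<mu>. separated_by_length A B \<mu>")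
  case True
  then have "separated_by_length A B (alpha1_sep A B)"
    unfolding alpha1_sep_def by (auto intro: LeastI_ex)
  then show ?thesis unfolding separated_by_length_def closed_sequence_def by auto
qed (simp add: alpha1_sep_def)

lemma alpha1_le_iff:
  assumes "is_limit \<mu>" "\<mu> < omega1"
  shows "alpha1 f \<le> \<mu> \<longleftrightarrow>
    (\<forall>p\<in>\<rat>. \<forall>q\<in>\<rat>. p < q \<longrightarrow> rank_separated \<mu> {x. f x \<le> p} {x. q \<le> f x})"
proof -
  let ?I = "{(p, q). p \<in> \<rat> \<and> q \<in> \<rat> \<and> p < (q :: real)}"
  let ?g = "\<lambda>(p, q). alpha1_sep {x. f x \<le> p} {x. q \<le> f x}"
  have "(0, 1) \<in> ?I" by simp
  then have "?I \<noteq> {}" by blast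
  moreover have "bdd_above (?g ` ?I)"
    by (rule bdd_aboveI[of _ omega1]) (auto simp: alpha1_sep_le_omega1)
  ultimately have "alpha1 f \<le> \<mu> \<longleftrightarrow> (\<forall>i\<in>?I. ?g i \<le> \<mu>)"
    unfolding alpha1_def by (rule cSUP_le_iff)
  also have "\<dots> \<longleftrightarrow> (\<forall>p\<in>\<rat>. \<forall>q\<in>\<rat>. p < q \<longrightarrow> alpha1_sep {x. f x \<le> p} {x. q \<le> f x} \<le> \<mu>)"
    by auto
  finally show ?thesis by (simp add: rank_separated_iff_alpha1_sep[OF assms])
qed

subsection \<open>Functions of small oscillation on the level sets of a rank\<close>

text \<open>An oscillation index in rank form: the sets \<open>{x. \<eta> \<le> \<rho> x}\<close>
  are the stages of a derivation by closed sets, and \<open>f\<close> has small local oscillation on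
  each difference of consecutive stages.\<close>

definition osc_ranked :: "real \<Rightarrow> ordinal \<Rightarrow> ('a::topological_space \<Rightarrow> real) \<Rightarrow> bool" where
  "osc_ranked \<epsilon> b f \<longleftrightarrow> (\<exists>\<rho>. usc_rank \<rho> \<and> (\<forall>x. \<rho> x < b) \<and>
     (\<forall>x. \<forall>\<^sub>F y in nhds x. \<rho> y = \<rho> x \<longrightarrow> \<bar>f y - f x\<bar> < \<epsilon>))"

lemma osc_rankedI:
  assumes "usc_rank \<rho>" "\<And>x. \<rho> x < b" "\<And>x. \<forall>\<^sub>F y in nhds x. \<rho> y = \<rho> x \<longrightarrow> \<bar>f y - f x\<bar> < \<epsilon>"
  shows "osc_ranked \<epsilon> b f"
  using assms unfolding osc_ranked_def by blast

text \<open>The natural sum of the two ranks works: by \<open>nsum_eqD\<close>, nearby points of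
  equal sum agree in both ranks, so both estimates apply.\<close>

lemma osc_ranked_add:
  assumes "osc_ranked \<epsilon> a f" "osc_ranked \<delta> b g"
    and "\<And>c d. c < a \<Longrightarrow> d < b \<Longrightarrow> nsum c d < e"
  shows "osc_ranked (\<epsilon> + \<delta>) e (\<lambda>x. f x + g x)"
proof -
  obtain \<rho> where \<rho>: "usc_rank \<rho>" "\<And>x. \<rho> x < a" "\<And>x. \<forall>\<^sub>F y in nhds x. \<rho> y = \<rho> x \<longrightarrow> \<bar>f y - f x\<bar> < \<epsilon>"
    using assms(1) unfolding osc_ranked_def by blast
  obtain \<sigma> where \<sigma>: "usc_rank \<sigma>" "\<And>x. \<sigma> x < b" "\<And>x. \<forall>\<^sub>F y in nhds x. \<sigma> y = \<sigma> x \<longrightarrow> \<bar>g y - g x\<bar> < \<delta>"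
    using assms(2) unfolding osc_ranked_def by blast
  show ?thesis
  proof (rule osc_rankedI)
    show "usc_rank (\<lambda>x. nsum (\<rho> x) (\<sigma> x))" using \<rho> \<sigma> by (intro usc_rank_nsum)
    show "nsum (\<rho> x) (\<sigma> x) < e" for x using \<rho> \<sigma> assms(3) by blast
    fix x
    show "\<forall>\<^sub>F y in nhds x. nsum (\<rho> y) (\<sigma> y) = nsum (\<rho> x) (\<sigma> x) \<longrightarrow>
        \<bar>f y + g y - (f x + g x)\<bar> < \<epsilon> + \<delta>"
      using usc_rankD[OF \<rho>(1), of x] usc_rankD[OF \<sigma>(1), of x] \<rho>(3)[of x] \<sigma>(3)[of x]
    proof eventually_elim
      case (elim y)
      show ?case
      proof
        assume "nsum (\<rho> y) (\<sigma> y) = nsum (\<rho> x) (\<sigma> x)"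
        then have "\<rho> y = \<rho> x" "\<sigma> y = \<sigma> x" using nsum_eqD elim by blast+
        then show "\<bar>f y + g y - (f x + g x)\<bar> < \<epsilon> + \<delta>" using elim by linarith
      qed
    qed
  qed
qed

lemma osc_ranked_abs_cong:
  assumes "osc_ranked \<epsilon> b f" "\<And>x y. \<bar>g y - g x\<bar> = \<bar>f y - f x\<bar>"
  shows "osc_ranked \<epsilon> b g"
  using assms unfolding osc_ranked_def by simp

lemma osc_ranked_uminus: "osc_ranked \<epsilon> b f \<Longrightarrow> osc_ranked \<epsilon> b (\<lambda>x. - f x)"
  by (erule osc_ranked_abs_cong) simp

text \<open>On a level set of \<open>\<rho>\<close> the points near which \<open>f\<close> stays
  below \<open>q\<close> form a relatively open set, so they may receive the smaller, even value
  \<open>double (\<rho> x)\<close>, and the others its successor. Doubling keeps distinct levels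
  apart.\<close>

lemma osc_ranked_imp_separated:
  assumes "is_limit \<mu>" "osc_ranked (q - p) \<mu> f"
  shows "rank_separated \<mu> {x. f x \<le> p} {x. q \<le> f x}"
proof -
  obtain \<rho> where \<rho>: "usc_rank \<rho>" "\<And>x. \<rho> x < \<mu>" "\<And>x. \<forall>\<^sub>F y in nhds x. \<rho> y = \<rho> x \<longrightarrow> \<bar>f y - f x\<bar> < q - p"
    using assms(2) unfolding osc_ranked_def by blast
  define P where "P x \<longleftrightarrow> (\<forall>\<^sub>F y in nhds x. \<rho> y = \<rho> x \<longrightarrow> f y < q)" for x
  define \<sigma> where "\<sigma> x = (if P x then double (\<rho> x) else osucc (double (\<rho> x)))" for x
  have "usc_rank \<sigma>"
    unfolding usc_rank_def
  proof
    fix x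
    have "\<forall>\<^sub>F y in nhds x. \<rho> y = \<rho> x \<longrightarrow> P x \<longrightarrow> P y"
    proof (cases "P x")
      case True
      \<comment> \<open>The local condition \<open>P\<close> holds at all nearby points of the same
        rank.\<close>
      then have "\<forall>\<^sub>F y in nhds x. \<forall>\<^sub>F z in nhds y. \<rho> z = \<rho> x \<longrightarrow> f z < q"
        unfolding P_def eventually_eventually by simp
      then show ?thesis by eventually_elim (simp add: P_def)
    qed simp
    with usc_rankD[OF \<rho>(1), of x] show "\<forall>\<^sub>F y in nhds x. \<sigma> y \<le> \<sigma> x"
    proof eventually_elim
      case (elim y)
      show ?case
      proof (cases "\<rho> y = \<rho> x")
        case True
        then show ?thesis using elim by (auto simp: \<sigma>_def less_imp_le)
      next
        case False
        then have "osucc (double (\<rho> y)) < double (\<rho> x)" using elim osucc_double_less by simp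
        moreover have "\<sigma> y \<le> osucc (double (\<rho> y))" "double (\<rho> x) \<le> \<sigma> x"
          by (simp_all add: \<sigma>_def less_imp_le)
        ultimately show ?thesis by (meson le_less_trans less_imp_le less_le_trans)
      qed
    qed
  qed
  moreover have "\<sigma> x < \<mu>" for x
    using assms(1) \<rho>(2) by (simp add: \<sigma>_def double_less_limit is_limit_osucc)
  moreover have "even_ord (\<sigma> x)" if "f x \<le> p" for x
  proof -
    have "P x" using \<rho>(3)[of x] unfolding P_def by eventually_elim (use that in auto)
    then show ?thesis by (simp add: \<sigma>_def even_ord_double)
  qed
  moreover have "\<not> even_ord (\<sigma> x)" if "q \<le> f x" for x
  proof -
    have "\<not> P x" using eventually_nhds_x_imp_x that unfolding P_def by fastforce
    then show ?thesis by (simp add: \<sigma>_def even_ord_double)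
  qed
  ultimately show ?thesis unfolding rank_separated_def by blast
qed

text \<open>Consecutive points of a fine rational grid are separated, and the finitely many ranks
  are added. Points agreeing in all these ranks have the same parities, so their values differ by at
  most two grid steps.\<close>

lemma separated_imp_osc_ranked:
  fixes f :: "'a::topological_space \<Rightarrow> real"
  assumes bdd: "bounded (range f)" and "\<epsilon> > 0"
    and sep: "\<forall>p\<in>\<rat>. \<forall>q\<in>\<rat>. p < q \<longrightarrow> rank_separated (omega_pow c) {x. f x \<le> p} {x. q \<le> f x}"
  shows "osc_ranked \<epsilon> (omega_pow c) f"
proof -
  obtain M where "\<And>x. \<bar>f x\<bar> \<le> M"
    using bdd unfolding bounded_iff by auto
  then obtain m :: nat where m: "\<And>x. \<bar>f x\<bar> \<le> real m"
    by (meson order_trans real_arch_simple)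
  obtain n :: nat where n: "n > 0" "1 / real n < \<epsilon> / 3"
    using assms(2) by (metis ex_inverse_of_nat_less divide_pos_pos inverse_eq_divide zero_less_numeral)
  define p where "p i = real i / real n - real m" for i
  have "p i \<in> \<rat>" "p i < p (Suc i)" for i
    using n by (auto simp: p_def divide_strict_right_mono)
  then have "\<forall>i. \<exists>\<sigma>. usc_rank \<sigma> \<and> (\<forall>x. \<sigma> x < omega_pow c) \<and>
      (\<forall>x\<in>{x. f x \<le> p i}. even_ord (\<sigma> x)) \<and> (\<forall>x\<in>{x. p (Suc i) \<le> f x}. \<not> even_ord (\<sigma> x))"
    using sep unfolding rank_separated_def by blast
  then obtain \<sigma> where \<sigma>: "\<And>i. usc_rank (\<sigma> i)" "\<And>i x. \<sigma> i x < omega_pow c"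
    "\<And>i x. f x \<le> p i \<Longrightarrow> even_ord (\<sigma> i x)" "\<And>i x. p (Suc i) \<le> f x \<Longrightarrow> \<not> even_ord (\<sigma> i x)"
    unfolding choice_iff by blast
  \<comment> \<open>Enough grid points, spaced \<open>1 / n\<close> apart, to cover the interval
    from \<open>- m\<close> to \<open>m\<close>.\<close>
  define N where "N = 2 * m * n + 1"
  have close: "f y \<le> f x + 2 / real n" if "\<And>i. i < N \<Longrightarrow> \<sigma> i y = \<sigma> i x" for x y
  proof (rule ccontr)
    assume far: "\<not> f y \<le> f x + 2 / real n"
    \<comment> \<open>The first grid point at or above \<open>f x\<close>; the following one is at
      most \<open>f x + 2 / n\<close>, so the parity of \<open>\<sigma> i\<close> would differ at
      \<open>x\<close> and \<open>y\<close>.\<close>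
    define i where "i = nat \<lceil>(f x + m) * n\<rceil>"
    have nn: "0 \<le> (f x + m) * n" using m[of x] by (auto intro: mult_nonneg_nonneg)
    have i: "(f x + m) * n \<le> i" "real i < (f x + m) * n + 1"
      unfolding i_def using nn by linarith+
    have "(f x + m) * n \<le> (2 * real m) * n" using m[of x] by (intro mult_right_mono) auto
    then have "real i < real N" using i unfolding N_def by simp
    then have "i < N" by simp
    have "f x \<le> p i" using i(1) n by (simp add: p_def field_simps)
    moreover have "p (Suc i) \<le> f x + 2 / n" 
    proof -
      have "real (Suc i) \<le> (f x + m + 2 / n) * n" using i(2) n by (simp add: distrib_right)
      then have "real (Suc i) / n \<le> f x + m + 2 / n" using n by (simp only: pos_divide_le_eq of_nat_0_less_iff)
      then show ?thesis unfolding p_def by linarith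
    qed
    then have "p (Suc i) \<le> f y" using far by simp
    ultimately show False using \<sigma>(3,4) that[OF \<open>i < N\<close>] by metis
  qed
  show ?thesis
  proof (rule osc_rankedI)
    show "usc_rank (\<lambda>x. nsums N (\<lambda>i. \<sigma> i x))" using \<sigma> by (intro usc_rank_nsums)
    show "nsums N (\<lambda>i. \<sigma> i x) < omega_pow c" for x using \<sigma> by (intro nsums_less_omega_pow)
    fix x
    have "\<forall>\<^sub>F y in nhds x. nsums N (\<lambda>i. \<sigma> i y) = nsums N (\<lambda>i. \<sigma> i x) \<longrightarrow> (\<forall>i<N. \<sigma> i y = \<sigma> i x)"
      using \<sigma> by (intro eventually_nsums_eqD)
    then show "\<forall>\<^sub>F y in nhds x. nsums N (\<lambda>i. \<sigma> i y) = nsums N (\<lambda>i. \<sigma> i x) \<longrightarrow> \<bar>f y - f x\<bar> < \<epsilon>"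
    proof eventually_elim
      case (elim y)
      show ?case
      proof
        assume "nsums N (\<lambda>i. \<sigma> i y) = nsums N (\<lambda>i. \<sigma> i x)"
        then have "f y \<le> f x + 2 / real n" "f x \<le> f y + 2 / real n"
          using elim close by metis+
        moreover have "2 / real n < \<epsilon>" using n assms(2) by (simp add: field_simps)
        ultimately show "\<bar>f y - f x\<bar> < \<epsilon>" by linarith
      qed
    qed
  qed
qed

lemma usc_eventually_less: "usc g \<Longrightarrow> g x < c \<Longrightarrow> \<forall>\<^sub>F y in nhds x. g y < c"
  unfolding usc_def by (metis (mono_tags, lifting) eventually_nhds mem_Collect_eq)

lemma osc_ranked_const: "0 < b \<Longrightarrow> 0 < \<epsilon> \<Longrightarrow> osc_ranked \<epsilon> b (\<lambda>x. c)"
  unfolding osc_ranked_def usc_rank_def by (intro exI[of _ "\<lambda>x. 0"]) simp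

text \<open>The rank is the number of the band of width \<open>\<epsilon>\<close> containing the
  value. Upper semicontinuity of \<open>g\<close> prevents this number from rising nearby, and
  boundedness leaves finitely many bands.\<close>

lemma usc_imp_osc_ranked:
  assumes "usc g" "\<And>x. 0 \<le> g x" "\<And>x. g x \<le> M" "\<epsilon> > 0"
  shows "osc_ranked \<epsilon> ((osucc ^^ Suc (nat \<lfloor>M / \<epsilon>\<rfloor>)) 0) g"
proof -
  define k where "k x = nat \<lfloor>g x / \<epsilon>\<rfloor>" for x
  have k: "k x * \<epsilon> \<le> g x" "g x < (real (k x) + 1) * \<epsilon>" for x
  proof -
    have "real (k x) = of_int \<lfloor>g x / \<epsilon>\<rfloor>" unfolding k_def using assms(2,4) by simp
    then have "k x \<le> g x / \<epsilon>" "g x / \<epsilon> < k x + 1" by linarith+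
    then show "k x * \<epsilon> \<le> g x" "g x < (real (k x) + 1) * \<epsilon>" using assms(4) by (simp_all add: field_simps)
  qed
  have le_iff: "(osucc ^^ i) 0 \<le> (osucc ^^ j) 0 \<longleftrightarrow> i \<le> j" for i j
    by (simp add: not_less[symmetric])
  show ?thesis
  proof (rule osc_rankedI)
    have ev: "\<forall>\<^sub>F y in nhds x. k y \<le> k x" for x
      using usc_eventually_less[OF assms(1) k(2)[of x]]
    proof eventually_elim
      case (elim y)
      then have "real (k y) * \<epsilon> < (real (k x) + 1) * \<epsilon>" using k(1)[of y] by linarith
      then have "real (k y) < real (k x) + 1" using assms(4) by (simp add: mult_less_cancel_right)
      then show ?case by linarith
    qed
    then show "usc_rank (\<lambda>x. (osucc ^^ k x) 0)" by (simp add: usc_rank_def le_iff)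
    have "k x \<le> nat \<lfloor>M / \<epsilon>\<rfloor>" for x
      unfolding k_def using assms by (intro nat_mono floor_mono divide_right_mono) auto
    then show "(osucc ^^ k x) 0 < (osucc ^^ Suc (nat \<lfloor>M / \<epsilon>\<rfloor>)) 0" for x
      by (simp only: osucc_funpow_less_iff less_Suc_eq_le)
    show "\<forall>\<^sub>F y in nhds x. (osucc ^^ k y) 0 = (osucc ^^ k x) 0 \<longrightarrow> \<bar>g y - g x\<bar> < \<epsilon>" for x
    proof (intro always_eventually allI impI)
      fix y assume "(osucc ^^ k y) 0 = (osucc ^^ k x) 0"
      then have "k y = k x" using le_iff by (metis order_antisym order_refl)
      then show "\<bar>g y - g x\<bar> < \<epsilon>" using k[of x] k[of y] by (simp add: algebra_simps abs_less_iff)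
    qed
  qed
qed

text \<open>The ranks \<open>r i\<close> are glued along the first index at which \<open>u i\<close> drops below the threshold; the
  blocks \<open>[B i, B i + b i)\<close> are placed one after the other below \<open>W\<close>.\<close>

lemma glue_ranks_along_threshold:
  fixes u g :: "'i::wellorder \<Rightarrow> 'a::topological_space \<Rightarrow> real"
  assumes u: "\<And>i. i \<in> I \<Longrightarrow> usc (u i)"
    and r: "\<And>i. i \<in> I \<Longrightarrow> usc_rank (r i)" "\<And>i x. i \<in> I \<Longrightarrow> r i x < b i"
      "\<And>i x. i \<in> I \<Longrightarrow> \<forall>\<^sub>F y in nhds x. r i y = r i x \<longrightarrow> \<bar>g i y - g i x\<bar> < \<epsilon>"
    and B: "\<And>i j. i \<in> I \<Longrightarrow> j \<in> I \<Longrightarrow> i < j \<Longrightarrow> oplus (B i) (b i) \<le> B j"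
      "\<And>i. i \<in> I \<Longrightarrow> oplus (B i) (b i) \<le> W"
  shows "\<exists>\<rho>. usc_rank \<rho> \<and> (\<forall>x. \<rho> x \<le> W) \<and> (\<forall>x. \<rho> x < W \<longleftrightarrow> (\<exists>i\<in>I. u i x < t)) \<and>
    (\<forall>x. \<rho> x < W \<longrightarrow> (\<forall>\<^sub>F y in nhds x. \<rho> y = \<rho> x \<longrightarrow>
      (\<exists>i\<in>I. u i x < t \<and> u i y < t \<and> \<bar>g i y - g i x\<bar> < \<epsilon>)))"
proof -
  define P where "P x \<longleftrightarrow> (\<exists>i\<in>I. u i x < t)" for x
  define \<tau> where "\<tau> x = (LEAST i. i \<in> I \<and> u i x < t)" for x
  \<comment> \<open>The value \<open>W\<close> is reserved for the points where no
    \<open>u i\<close> falls below \<open>t\<close>.\<close>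
  define \<rho> where "\<rho> x = (if P x then oplus (B (\<tau> x)) (r (\<tau> x) x) else W)" for x
  have \<tau>: "\<tau> x \<in> I" "u (\<tau> x) x < t" if "P x" for x
    using that LeastI_ex[of "\<lambda>i. i \<in> I \<and> u i x < t"] unfolding P_def \<tau>_def by blast+
  have \<tau>_le: "\<tau> x \<le> i" if "i \<in> I" "u i x < t" for x i
    unfolding \<tau>_def using that by (auto intro: Least_le)
  have block: "\<rho> x < oplus (B (\<tau> x)) (b (\<tau> x))" if "P x" for x
    using that \<tau>[OF that] r(2) by (simp add: \<rho>_def)
  have less: "\<rho> x < W" if "P x" for x
    using block[OF that] B(2)[OF \<tau>(1)[OF that]] by (rule order_less_le_trans)
  have le: "\<rho> x \<le> W" for x
    using less[of x] by (cases "P x") (auto simp: \<rho>_def)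
  have near: "\<forall>\<^sub>F y in nhds x. P y \<and> \<rho> y \<le> \<rho> x \<and>
      (\<rho> y = \<rho> x \<longrightarrow> u (\<tau> x) y < t \<and> \<bar>g (\<tau> x) y - g (\<tau> x) x\<bar> < \<epsilon>)" if "P x" for x
    using usc_eventually_less[OF u[OF \<tau>(1)[OF that]] \<tau>(2)[OF that]]
      usc_rankD[OF r(1)[OF \<tau>(1)[OF that]], of x] r(3)[OF \<tau>(1)[OF that], of x]
  proof eventually_elim
    case (elim y)
    have "P y" using elim \<tau>[OF that] P_def by blast
    \<comment> \<open>Upper semicontinuity keeps \<open>u (\<tau> x)\<close> below \<open>t\<close>
      at \<open>y\<close>, so the first index cannot increase. A smaller index means an entirely
      lower block; an equal one reduces to the rank \<open>r (\<tau> x)\<close>.\<close>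
    have "\<tau> y \<le> \<tau> x" using elim \<tau>[OF that] \<tau>_le by blast
    then consider "\<tau> y < \<tau> x" | "\<tau> y = \<tau> x" by fastforce
    then show ?case
    proof cases
      case 1
      have "\<rho> y < oplus (B (\<tau> y)) (b (\<tau> y))" using block \<open>P y\<close> by blast
      also have "\<dots> \<le> B (\<tau> x)" using 1 B(1) \<tau> \<open>P y\<close> that by blast
      also have "\<dots> \<le> \<rho> x" using that by (simp add: \<rho>_def le_oplus)
      finally have "\<rho> y < \<rho> x" .
      then show ?thesis using \<open>P y\<close> by (simp add: less_imp_le less_imp_neq)
    next
      case 2
      then show ?thesis using \<open>P y\<close> that elim by (simp add: \<rho>_def order_antisym_conv)
        (metis oplus_less_iff order.order_iff_strict less_irrefl)
    qed
  qed
  show ?thesis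
  proof (intro exI[of _ \<rho>] conjI allI impI)
    show "usc_rank \<rho>"
      unfolding usc_rank_def
    proof
      fix x show "\<forall>\<^sub>F y in nhds x. \<rho> y \<le> \<rho> x"
      proof (cases "P x")
        case True
        from near[OF True] show ?thesis by eventually_elim blast
      next
        case False
        then show ?thesis using le by (simp add: \<rho>_def)
      qed
    qed
    show "\<rho> x \<le> W" for x by (rule le)
    have P_iff: "\<rho> x < W \<longleftrightarrow> P x" for x using less by (auto simp: \<rho>_def)
    then show "\<rho> x < W \<longleftrightarrow> (\<exists>i\<in>I. u i x < t)" for x by (simp add: P_def)
    fix x assume "\<rho> x < W"
    then have "P x" using P_iff by simp
    from near[OF this] show "\<forall>\<^sub>F y in nhds x. \<rho> y = \<rho> x \<longrightarrow>
      (\<exists>i\<in>I. u i x < t \<and> u i y < t \<and> \<bar>g i y - g i x\<bar> < \<epsilon>)"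
      by eventually_elim (use \<tau>[OF \<open>P x\<close>] in blast)
  qed
qed

subsection \<open>Alternating sums have ranks\<close>

text \<open>Indexing by all ordinals lets blocks of any length start at an arbitrary
  \<open>\<theta>\<close>; members of \<open>DUSB1\<close> are later extended by zeros.\<close>

locale usc_chain =
  fixes f :: "ordinal \<Rightarrow> 'a::topological_space \<Rightarrow> real"
  assumes usc: "usc (f \<eta>)" and nonneg: "0 \<le> f \<eta> x"
    and dec: "\<zeta> \<le> \<eta> \<Longrightarrow> f \<eta> x \<le> f \<zeta> x"
    and bdd: "\<exists>M. \<forall>x. f 0 x \<le> M"
begin

abbreviation S :: "ordinal \<Rightarrow> 'a \<Rightarrow> real" where "S \<equiv> alt_sum f"

text \<open>Monotonicity at earlier even stages is a premise, so that the estimate serves both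
  inside the induction of \<open>alt_sum_bounds\<close> and after it. \<open>L\<close> bounds only
  the terms below \<open>\<theta>\<close>, since the sum at a limit does not see
  \<open>f \<theta>\<close>.\<close>

lemma alt_sum_limit_bounds_aux:
  assumes "is_limit \<theta>" "even_ord \<zeta>" "\<zeta> < \<theta>" "\<And>m. m < \<theta> \<Longrightarrow> L \<le> f m x"
    and IH: "\<And>m z. m < \<theta> \<Longrightarrow> z \<le> m \<Longrightarrow> even_ord z \<Longrightarrow> even_ord m \<Longrightarrow>
      S z x \<le> S m x \<and> S m x + f m x \<le> S z x + f z x"
  shows "S \<zeta> x \<le> S \<theta> x" "S \<theta> x \<le> S \<zeta> x + f \<zeta> x - L"
proof -
  let ?A = "{\<eta>. \<eta> < \<theta> \<and> even_ord \<eta>}"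
  have S: "S \<theta> x = (SUP \<eta>\<in>?A. S \<eta> x)" using assms(1) by simp
  have ub: "S \<eta> x \<le> S \<zeta> x + f \<zeta> x - L" if "\<eta> \<in> ?A" for \<eta>
  proof -
    \<comment> \<open>The stages \<open>\<eta>\<close> and \<open>\<zeta>\<close> may come in either
      order; comparing both with their maximum covers the two cases.\<close>
    have m: "max \<eta> \<zeta> < \<theta>" "even_ord (max \<eta> \<zeta>)" using that assms(2,3) by (auto simp: max_def)
    have "S \<eta> x \<le> S (max \<eta> \<zeta>) x" using IH[OF m(1), of \<eta>] m that by simp
    moreover have "S (max \<eta> \<zeta>) x + f (max \<eta> \<zeta>) x \<le> S \<zeta> x + f \<zeta> x" 
      using IH[OF m(1), of \<zeta>] m assms(2) by simp
    ultimately show ?thesis using assms(4)[OF m(1)] by linarith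
  qed
  then have "bdd_above ((\<lambda>\<eta>. S \<eta> x) ` ?A)" by (intro bdd_aboveI[of _ "S \<zeta> x + f \<zeta> x - L"]) auto
  then show "S \<zeta> x \<le> S \<theta> x" unfolding S using assms(2,3) by (intro cSUP_upper) auto
  show "S \<theta> x \<le> S \<zeta> x + f \<zeta> x - L" unfolding S using assms(2,3) ub by (intro cSUP_least) auto
qed

text \<open>Transfinite alternating series estimate: over even stages the sums \<open>S\<close>
  increase and \<open>S + f\<close> decreases, because the terms decrease. At an odd stage,
  \<open>S \<theta> x - f \<theta> x\<close> is the next even sum.\<close>

lemma alt_sum_bounds:
  "\<zeta> \<le> \<theta> \<Longrightarrow> even_ord \<zeta> \<Longrightarrow>
    (if even_ord \<theta> then S \<zeta> x \<le> S \<theta> x \<and> S \<theta> x + f \<theta> x \<le> S \<zeta> x + f \<zeta> x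
     else S \<zeta> x \<le> S \<theta> x - f \<theta> x \<and> S \<theta> x \<le> S \<zeta> x + f \<zeta> x)"
proof (induction \<theta> arbitrary: \<zeta> rule: less_induct)
  case (less \<theta>)
  show ?case
  proof (cases "\<zeta> = \<theta>")
    case False
    then have "\<zeta> < \<theta>" using less.prems by simp
    show ?thesis
    proof (cases \<theta> rule: ordinal_cases)
      case zero then show ?thesis using \<open>\<zeta> < \<theta>\<close> by simp
    next
      case (succ d)
      then have "\<zeta> \<le> d" using \<open>\<zeta> < \<theta>\<close> less_osucc_iff by simp
      moreover have "f \<theta> x \<le> f d x" using succ dec less_imp_le osucc_greater by metis
      ultimately show ?thesis 
        using less.IH[of d \<zeta>] less.prems succ nonneg[of \<theta> x] by (auto simp: ord_sign_def)
    next
      case limit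
      have IH: "S z x \<le> S m x \<and> S m x + f m x \<le> S z x + f z x"
        if "m < \<theta>" "z \<le> m" "even_ord z" "even_ord m" for m z
        using less.IH[of m z] that by simp
      have "f \<theta> x \<le> f m x" if "m < \<theta>" for m using that dec by simp
      then show ?thesis
        using alt_sum_limit_bounds_aux[OF limit less.prems(2) \<open>\<zeta> < \<theta>\<close> _ IH, of "f \<theta> x"] limit
        by (simp add: even_ord_limit)
    qed
  qed (use less in simp)
qed

lemma alt_sum_limit_bounds:
  assumes "is_limit \<theta>" "even_ord \<zeta>" "\<zeta> < \<theta>" "\<And>m. m < \<theta> \<Longrightarrow> L \<le> f m x"
  shows "S \<zeta> x \<le> S \<theta> x" "S \<theta> x \<le> S \<zeta> x + f \<zeta> x - L"
proof -
  have "S z x \<le> S m x \<and> S m x + f m x \<le> S z x + f z x"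
    if "m < \<theta>" "z \<le> m" "even_ord z" "even_ord m" for m z
    using alt_sum_bounds[of z m x] that by simp
  then show "S \<zeta> x \<le> S \<theta> x" "S \<theta> x \<le> S \<zeta> x + f \<zeta> x - L"
    using alt_sum_limit_bounds_aux[OF assms, simplified] by blast+
qed

text \<open>Terms from \<open>\<zeta>\<close> on lie between \<open>L\<close> and
  \<open>L + \<epsilon>\<close>, so the tail is close to an alternation of the constant
  \<open>L\<close>: it contributes about \<open>0\<close> after an even stage and about
  \<open>- L\<close> after an odd one.\<close>

lemma alt_sum_near_limit:
  assumes "is_limit \<theta>" "\<zeta> < \<theta>" "\<And>m. m < \<theta> \<Longrightarrow> L \<le> f m x" "f \<zeta> x \<le> L + \<epsilon>"
  shows "\<bar>S \<theta> x - (S \<zeta> x - (if even_ord \<zeta> then 0 else L))\<bar> \<le> \<epsilon>"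
proof (cases "even_ord \<zeta>")
  case True
  then show ?thesis using alt_sum_limit_bounds[OF assms(1) _ assms(2,3)] assms(4) by fastforce
next
  case False
  then have "even_ord (osucc \<zeta>)" "osucc \<zeta> < \<theta>" using assms is_limit_osucc by auto
  then have "S (osucc \<zeta>) x \<le> S \<theta> x" "S \<theta> x \<le> S (osucc \<zeta>) x + f (osucc \<zeta>) x - L"
    using alt_sum_limit_bounds[OF assms(1) _ _ assms(3)] by blast+
  moreover have "S (osucc \<zeta>) x = S \<zeta> x - f \<zeta> x" using False by (simp add: ord_sign_def)
  moreover have "f (osucc \<zeta>) x \<le> f \<zeta> x" using dec by (simp add: less_imp_le)
  ultimately show ?thesis using False assms(4) by (simp add: abs_le_iff)
qed

text \<open>The rank controls partial sums at a stage where the term has dropped below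
  \<open>t\<close>, not yet the sum up to \<open>\<theta>'\<close>. The value \<open>W\<close> marks
  the points where no term drops that far.\<close>

definition threshold_ranked :: "ordinal \<Rightarrow> ordinal \<Rightarrow> ordinal \<Rightarrow> bool" where
  "threshold_ranked \<theta> \<theta>' W \<longleftrightarrow> (\<forall>\<epsilon>>0. \<forall>t. \<exists>\<rho>. usc_rank \<rho> \<and> (\<forall>x. \<rho> x \<le> W) \<and>
    (\<forall>x. \<rho> x < W \<longleftrightarrow> (\<exists>\<zeta><\<theta>'. f \<zeta> x < t)) \<and>
    (\<forall>x. \<rho> x < W \<longrightarrow> (\<forall>\<^sub>F y in nhds x. \<rho> y = \<rho> x \<longrightarrow>
      (\<exists>\<zeta><\<theta>'. f \<zeta> x < t \<and> f \<zeta> y < t \<and> \<bar>(S \<zeta> y - S \<theta> y) - (S \<zeta> x - S \<theta> x)\<bar> < \<epsilon>))))"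

text \<open>As the terms decrease, it suffices to look at the cofinal stages \<open>Z i\<close>,
  whose ranks are then glued in consecutive blocks.\<close>

lemma threshold_rankedI:
  fixes Z :: "'i::wellorder \<Rightarrow> ordinal"
  assumes Z: "\<And>i. i \<in> I \<Longrightarrow> Z i < \<theta>'" "\<And>m. m < \<theta>' \<Longrightarrow> \<exists>i\<in>I. m \<le> Z i"
    and r: "\<And>\<epsilon>. \<epsilon> > 0 \<Longrightarrow> \<exists>b B. (\<forall>i\<in>I. osc_ranked \<epsilon> (b i) (\<lambda>x. S (Z i) x - S \<theta> x)) \<and>
       (\<forall>i\<in>I. \<forall>j\<in>I. i < j \<longrightarrow> oplus (B i) (b i) \<le> B j) \<and> (\<forall>i\<in>I. oplus (B i) (b i) \<le> W)"
  shows "threshold_ranked \<theta> \<theta>' W"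
  unfolding threshold_ranked_def
proof (intro allI impI)
  fix \<epsilon> t :: real assume "\<epsilon> > 0"
  then obtain b B where b: "\<And>i. i \<in> I \<Longrightarrow> osc_ranked \<epsilon> (b i) (\<lambda>x. S (Z i) x - S \<theta> x)"
    "\<And>i j. i \<in> I \<Longrightarrow> j \<in> I \<Longrightarrow> i < j \<Longrightarrow> oplus (B i) (b i) \<le> B j"
    "\<And>i. i \<in> I \<Longrightarrow> oplus (B i) (b i) \<le> W"
    using r by blast
  have "\<forall>i\<in>I. \<exists>\<sigma>. usc_rank \<sigma> \<and> (\<forall>x. \<sigma> x < b i) \<and> (\<forall>x. \<forall>\<^sub>F y in nhds x. \<sigma> y = \<sigma> x \<longrightarrow>
      \<bar>(S (Z i) y - S \<theta> y) - (S (Z i) x - S \<theta> x)\<bar> < \<epsilon>)"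
    using b(1) unfolding osc_ranked_def by simp
  then obtain \<sigma> where \<sigma>: "\<And>i. i \<in> I \<Longrightarrow> usc_rank (\<sigma> i)" "\<And>i x. i \<in> I \<Longrightarrow> \<sigma> i x < b i"
    "\<And>i x. i \<in> I \<Longrightarrow> \<forall>\<^sub>F y in nhds x. \<sigma> i y = \<sigma> i x \<longrightarrow>
      \<bar>(S (Z i) y - S \<theta> y) - (S (Z i) x - S \<theta> x)\<bar> < \<epsilon>"
    unfolding bchoice_iff by auto
  have Z_iff: "(\<exists>\<zeta><\<theta>'. f \<zeta> x < t) \<longleftrightarrow> (\<exists>i\<in>I. f (Z i) x < t)" for x
    using Z dec le_less_trans by metis
  obtain \<rho> where \<rho>: "usc_rank \<rho>" "\<And>x. \<rho> x \<le> W" "\<And>x. \<rho> x < W \<longleftrightarrow> (\<exists>i\<in>I. f (Z i) x < t)"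
    and near: "\<And>x. \<rho> x < W \<Longrightarrow> \<forall>\<^sub>F y in nhds x. \<rho> y = \<rho> x \<longrightarrow>
      (\<exists>i\<in>I. f (Z i) x < t \<and> f (Z i) y < t \<and> \<bar>(S (Z i) y - S \<theta> y) - (S (Z i) x - S \<theta> x)\<bar> < \<epsilon>)"
    using glue_ranks_along_threshold[of I "\<lambda>i. f (Z i)" \<sigma> b "\<lambda>i x. S (Z i) x - S \<theta> x" \<epsilon> B W t, OF usc \<sigma> b(2,3)]
    by blast
  show "\<exists>\<rho>. usc_rank \<rho> \<and> (\<forall>x. \<rho> x \<le> W) \<and> (\<forall>x. \<rho> x < W \<longleftrightarrow> (\<exists>\<zeta><\<theta>'. f \<zeta> x < t)) \<and>
    (\<forall>x. \<rho> x < W \<longrightarrow> (\<forall>\<^sub>F y in nhds x. \<rho> y = \<rho> x \<longrightarrow>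
      (\<exists>\<zeta><\<theta>'. f \<zeta> x < t \<and> f \<zeta> y < t \<and> \<bar>(S \<zeta> y - S \<theta> y) - (S \<zeta> x - S \<theta> x)\<bar> < \<epsilon>)))"
  proof (intro exI[of _ \<rho>] conjI allI impI)
    fix x assume "\<rho> x < W"
    from near[OF this] show "\<forall>\<^sub>F y in nhds x. \<rho> y = \<rho> x \<longrightarrow>
      (\<exists>\<zeta><\<theta>'. f \<zeta> x < t \<and> f \<zeta> y < t \<and> \<bar>(S \<zeta> y - S \<theta> y) - (S \<zeta> x - S \<theta> x)\<bar> < \<epsilon>)"
      by eventually_elim (use Z(1) in blast)
  qed (use \<rho> Z_iff in auto)
qed

text \<open>Replacing the sum up to \<open>\<theta>'\<close> by \<open>S \<zeta>\<close> costs at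
  most \<open>\<epsilon>\<close> at each point, up to a correction that depends only on
  \<open>\<zeta>\<close> and \<open>L\<close> and hence cancels; the third \<open>\<epsilon>\<close>
  comes from the rank.\<close>

lemma oscillation_bound:
  assumes "is_limit \<theta>'" "\<zeta> < \<theta>'" "\<And>m. m < \<theta>' \<Longrightarrow> L \<le> f m x" "\<And>m. m < \<theta>' \<Longrightarrow> L \<le> f m y"
    and "f \<zeta> x < L + \<epsilon>" "f \<zeta> y < L + \<epsilon>" "\<bar>(S \<zeta> y - S \<theta> y) - (S \<zeta> x - S \<theta> x)\<bar> < \<epsilon>"
  shows "\<bar>(S \<theta>' y - S \<theta> y) - (S \<theta>' x - S \<theta> x)\<bar> < 3 * \<epsilon>"
  using alt_sum_near_limit[OF assms(1-3), of \<epsilon>] alt_sum_near_limit[OF assms(1,2,4), of \<epsilon>] assms(5-7)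
  by linarith

text \<open>The ranks for the thresholds \<open>e\<close>, \<open>2 e\<close>, ...,
  \<open>N e\<close> are added. An equal sum forces the limiting size of the terms into the same
  band of width \<open>e\<close> at both points.\<close>

lemma threshold_ranked_imp_osc_ranked:
  assumes tr: "threshold_ranked \<theta> \<theta>' W" and lim: "is_limit \<theta>'" and c: "0 < c" "W < omega_pow c"
    and "\<epsilon> > 0"
  shows "\<exists>b<omega_pow c. osc_ranked \<epsilon> b (\<lambda>x. S \<theta>' x - S \<theta> x)"
proof -
  define e where "e = \<epsilon> / 3"
  have e: "e > 0" using assms(5) by (simp add: e_def)
  obtain M where M: "\<And>x. f 0 x \<le> M" using bdd by blast
  obtain N where N: "M < real N * e" using e reals_Archimedean3 by blast
  have "\<forall>j::nat. \<exists>\<rho>. usc_rank \<rho> \<and> (\<forall>x. \<rho> x \<le> W) \<and>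
    (\<forall>x. \<rho> x < W \<longleftrightarrow> (\<exists>\<zeta><\<theta>'. f \<zeta> x < (real j + 1) * e)) \<and>
    (\<forall>x. \<rho> x < W \<longrightarrow> (\<forall>\<^sub>F y in nhds x. \<rho> y = \<rho> x \<longrightarrow>
      (\<exists>\<zeta><\<theta>'. f \<zeta> x < (real j + 1) * e \<and> f \<zeta> y < (real j + 1) * e \<and> \<bar>(S \<zeta> y - S \<theta> y) - (S \<zeta> x - S \<theta> x)\<bar> < e)))"
    using tr e unfolding threshold_ranked_def by blast
  then obtain \<rho> where \<rho>: "\<And>j::nat. usc_rank (\<rho> j)" "\<And>j x. \<rho> j x \<le> W"
    "\<And>j x. \<rho> j x < W \<longleftrightarrow> (\<exists>\<zeta><\<theta>'. f \<zeta> x < (real j + 1) * e)"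
    and near: "\<And>j x. \<rho> j x < W \<Longrightarrow> \<forall>\<^sub>F y in nhds x. \<rho> j y = \<rho> j x \<longrightarrow>
      (\<exists>\<zeta><\<theta>'. f \<zeta> x < (real j + 1) * e \<and> f \<zeta> y < (real j + 1) * e \<and> \<bar>(S \<zeta> y - S \<theta> y) - (S \<zeta> x - S \<theta> x)\<bar> < e)"
    unfolding choice_iff by blast
  define R where "R x = nsums N (\<lambda>j. \<rho> j x)" for x
  have "osc_ranked \<epsilon> (osucc (nsums N (\<lambda>_. W))) (\<lambda>x. S \<theta>' x - S \<theta> x)"
  proof (rule osc_rankedI)
    show "usc_rank R" unfolding R_def using \<rho>(1) by (intro usc_rank_nsums)
    show "R x < osucc (nsums N (\<lambda>_. W))" for x
      unfolding less_osucc_iff R_def using \<rho>(2) by (intro nsums_mono)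
    fix x
    \<comment> \<open>The infimum of the terms at \<open>x\<close> lies in the band from
      \<open>j e\<close> to \<open>(j + 1) e\<close>.\<close>
    define j where "j = (LEAST j. \<rho> j x < W)"
    \<comment> \<open>Index \<open>N - 1\<close> has threshold \<open>N e\<close>, which exceeds
      \<open>M\<close>, so already the first term lies below it.\<close>
    have ex: "\<rho> (N - 1) x < W \<and> N > 0"
    proof -
      have "f 0 x < real N * e" using M[of x] N by simp
      moreover from this have "N > 0" using nonneg[of 0 x] by (cases N) auto
      ultimately show ?thesis unfolding \<rho>(3) using is_limit_pos[OF lim] by (auto simp: of_nat_diff)
    qed
    then have j: "\<rho> j x < W" "j < N" 
      unfolding j_def using LeastI[of "\<lambda>j. \<rho> j x < W" "N - 1"] Least_le[of "\<lambda>j. \<rho> j x < W" "N - 1"] by auto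
    \<comment> \<open>By minimality of \<open>j\<close> the earlier ranks equal \<open>W\<close> at
      \<open>x\<close>, hence also at any \<open>z\<close> agreeing with them, so no term drops
      below \<open>j e\<close>.\<close>
    have below: "real j * e \<le> f m z" if "m < \<theta>'" "\<And>i. i < j \<Longrightarrow> \<rho> i z = \<rho> i x" for m z
    proof (cases j)
      case 0 then show ?thesis using nonneg by simp
    next
      case (Suc i)
      then have "\<not> \<rho> i x < W" using not_less_Least[of i "\<lambda>j. \<rho> j x < W"] unfolding j_def by simp
      then have "\<not> f m z < (real i + 1) * e" using \<rho>(3) that Suc by (metis lessI)
      then show ?thesis using Suc by (simp add: add.commute)
    qed
    have "\<forall>\<^sub>F y in nhds x. R y = R x \<longrightarrow> (\<forall>i<N. \<rho> i y = \<rho> i x)"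
      unfolding R_def using \<rho>(1) by (intro eventually_nsums_eqD)
    with near[OF j(1)] show "\<forall>\<^sub>F y in nhds x. R y = R x \<longrightarrow>
      \<bar>(S \<theta>' y - S \<theta> y) - (S \<theta>' x - S \<theta> x)\<bar> < \<epsilon>"
    proof eventually_elim
      case (elim y)
      show ?case
      proof
        assume "R y = R x"
        then have eq: "\<rho> i y = \<rho> i x" if "i < N" for i using elim that by blast
        then obtain \<zeta> where \<zeta>: "\<zeta> < \<theta>'" "f \<zeta> x < (real j + 1) * e" "f \<zeta> y < (real j + 1) * e"
          "\<bar>(S \<zeta> y - S \<theta> y) - (S \<zeta> x - S \<theta> x)\<bar> < e" using elim j(2) by blast
        have "\<bar>(S \<theta>' y - S \<theta> y) - (S \<theta>' x - S \<theta> x)\<bar> < 3 * e"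
          by (rule oscillation_bound[OF lim \<zeta>(1) below below _ _ \<zeta>(4)])
            (use \<zeta> eq j(2) in \<open>auto simp: algebra_simps\<close>)
        then show "\<bar>(S \<theta>' y - S \<theta> y) - (S \<theta>' x - S \<theta> x)\<bar> < \<epsilon>" by (simp add: e_def)
      qed
    qed
  qed
  moreover have "osucc (nsums N (\<lambda>_. W)) < omega_pow c"
    by (rule is_limit_osucc[OF is_limit_omega_pow[OF c(1)] nsums_less_omega_pow]) (rule c(2))
  ultimately show ?thesis by blast
qed

text \<open>Every threshold is eventually met, so the rank never takes the value \<open>W\<close>;
  with \<open>L = 0\<close> a single threshold suffices and \<open>W\<close> itself is a strict
  bound.\<close>

lemma threshold_ranked_vanishing:
  assumes tr: "threshold_ranked \<theta> \<theta>' W" and lim: "is_limit \<theta>'"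
    and vanish: "\<And>x \<epsilon>. \<epsilon> > 0 \<Longrightarrow> \<exists>\<zeta><\<theta>'. f \<zeta> x < \<epsilon>" and "\<epsilon> > 0"
  shows "osc_ranked \<epsilon> W (\<lambda>x. S \<theta>' x - S \<theta> x)"
proof -
  define e where "e = \<epsilon> / 3"
  have e: "e > 0" using assms(4) by (simp add: e_def)
  then obtain \<rho> where \<rho>: "usc_rank \<rho>" "\<And>x. \<rho> x < W \<longleftrightarrow> (\<exists>\<zeta><\<theta>'. f \<zeta> x < e)"
    and near: "\<And>x. \<rho> x < W \<Longrightarrow> \<forall>\<^sub>F y in nhds x. \<rho> y = \<rho> x \<longrightarrow>
      (\<exists>\<zeta><\<theta>'. f \<zeta> x < e \<and> f \<zeta> y < e \<and> \<bar>(S \<zeta> y - S \<theta> y) - (S \<zeta> x - S \<theta> x)\<bar> < e)"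
    using tr unfolding threshold_ranked_def by blast
  have less: "\<rho> x < W" for x using \<rho>(2) vanish e by blast
  show ?thesis
  proof (rule osc_rankedI[OF \<rho>(1) less])
    fix x
    show "\<forall>\<^sub>F y in nhds x. \<rho> y = \<rho> x \<longrightarrow> \<bar>(S \<theta>' y - S \<theta> y) - (S \<theta>' x - S \<theta> x)\<bar> < \<epsilon>"
      using near[OF less[of x]]
    proof eventually_elim
      case (elim y)
      show ?case
      proof
        assume "\<rho> y = \<rho> x"
        then obtain \<zeta> where \<zeta>: "\<zeta> < \<theta>'" "f \<zeta> x < e" "f \<zeta> y < e"
          "\<bar>(S \<zeta> y - S \<theta> y) - (S \<zeta> x - S \<theta> x)\<bar> < e" using elim by blast
        have "\<bar>(S \<theta>' y - S \<theta> y) - (S \<theta>' x - S \<theta> x)\<bar> < 3 * e"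
          by (rule oscillation_bound[OF lim \<zeta>(1) _ _ _ _ \<zeta>(4), where L = 0]) (use \<zeta> nonneg in auto)
        then show "\<bar>(S \<theta>' y - S \<theta> y) - (S \<theta>' x - S \<theta> x)\<bar> < \<epsilon>" by (simp add: e_def)
      qed
    qed
  qed
qed

text \<open>The bound \<open>b\<close> may depend on \<open>\<epsilon>\<close>; being strictly below
  the next power of \<open>omega\<close>, it leaves room for further blocks.\<close>

definition blocks_ranked :: "ordinal \<Rightarrow> bool" where
  "blocks_ranked \<kappa> \<longleftrightarrow> (\<forall>\<theta>. \<forall>\<epsilon>>0. \<exists>b<omega_pow (osucc \<kappa>).
     osc_ranked \<epsilon> b (\<lambda>x. S (oplus \<theta> (omega_pow \<kappa>)) x - S \<theta> x))"

text \<open>The stages \<open>Z k\<close> advance by \<open>omega_pow d\<close>. The sum up to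
  \<open>Z k\<close> consists of \<open>k\<close> blocks, whose ranks are combined by
  \<open>osc_ranked_add\<close> while \<open>\<epsilon>\<close> is halved at each step.\<close>

lemma threshold_ranked_succ:
  assumes "blocks_ranked d"
  shows "threshold_ranked \<theta> (oplus \<theta> (omega_pow (osucc d))) (omega_pow (osucc d))"
proof -
  let ?W = "omega_pow (osucc d)" and ?w = "omega_pow d"
  define Z where "Z k = oplus \<theta> (nat_mult k ?w)" for k
  have pos: "0 < ?W" by (rule omega_pow_pos)
  have limW: "is_limit ?W" by (rule is_limit_omega_pow) (metis ordinal_zero_le osucc_greater order_le_less_trans)
  have mult: "nat_mult k ?w < ?W" for k
    unfolding less_omega_pow_osucc_iff
    using oplus_strict_mono[OF omega_pow_pos[of d], of "nat_mult k ?w"] by (intro exI[of _ "Suc k"]) simp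
  have ranks: "\<exists>b<?W. osc_ranked \<epsilon> b (\<lambda>x. S (Z k) x - S \<theta> x)" if "\<epsilon> > 0" for \<epsilon> k
    using that
  proof (induction k arbitrary: \<epsilon>)
    case 0
    have "osc_ranked \<epsilon> (osucc 0) (\<lambda>x. 0)" using 0 by (intro osc_ranked_const) auto
    then show ?case using is_limit_osucc[OF limW pos] by (intro exI[of _ "osucc 0"]) (simp add: Z_def)
  next
    case (Suc k)
    obtain b where b: "b < ?W" "osc_ranked (\<epsilon>/2) b (\<lambda>x. S (Z k) x - S \<theta> x)"
      using Suc.IH[of "\<epsilon>/2"] Suc.prems by auto
    have "0 < \<epsilon>/2" using Suc.prems by simp
    then obtain b' where b': "b' < ?W" "osc_ranked (\<epsilon>/2) b' (\<lambda>x. S (oplus (Z k) ?w) x - S (Z k) x)"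
      using assms unfolding blocks_ranked_def by blast
    have "osc_ranked (\<epsilon>/2 + \<epsilon>/2) (nsum b b')
        (\<lambda>x. (S (Z k) x - S \<theta> x) + (S (oplus (Z k) ?w) x - S (Z k) x))"
      by (rule osc_ranked_add[OF b(2) b'(2)]) (rule nsum_strict_mono)
    then have "osc_ranked \<epsilon> (nsum b b') (\<lambda>x. S (Z (Suc k)) x - S \<theta> x)"
      by (simp add: Z_def oplus_assoc)
    then show ?case using nsum_less_omega_pow[OF b(1) b'(1)] by blast
  qed
  show ?thesis
  proof (rule threshold_rankedI[of UNIV Z])
    show "Z k < oplus \<theta> ?W" for k using mult by (simp add: Z_def)
    show "\<exists>k\<in>UNIV. m \<le> Z k" if m: "m < oplus \<theta> ?W" for m
    proof -
      obtain c where c: "c < ?W" "m < oplus \<theta> c" using m less_oplus_limit_iff[OF limW] by blast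
      then obtain k where "c < nat_mult k ?w" using less_omega_pow_osucc_iff by blast
      then have "m < Z k" using c(2) unfolding Z_def by (meson oplus_strict_mono order_less_trans)
      then show ?thesis by (auto intro: less_imp_le)
    qed
    fix \<epsilon> :: real assume "\<epsilon> > 0"
    then obtain b where b: "\<And>k. b k < ?W" "\<And>k. osc_ranked \<epsilon> (b k) (\<lambda>x. S (Z k) x - S \<theta> x)"
      using ranks[of \<epsilon>] by metis
    \<comment> \<open>Blocks are laid end to end; each finite stretch stays below
      \<open>omega_pow (osucc d)\<close>.\<close>
    define B where "B = rec_nat 0 (\<lambda>k B. oplus B (b k))"
    have B: "B 0 = 0" "B (Suc k) = oplus (B k) (b k)" for k by (simp_all add: B_def)
    have less: "B k < ?W" for k by (induction k) (auto simp: B pos b oplus_less_omega_pow simp del: omega_pow.simps)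
    have "oplus (B i) (b i) \<le> B j" if "i < j" for i j
      using lift_Suc_mono_le[of B "Suc i" j] that by (simp add: B le_oplus)
    moreover have "oplus (B i) (b i) \<le> ?W" for i using less[of "Suc i"] by (simp add: B less_imp_le)
    ultimately show "\<exists>b B. (\<forall>i\<in>UNIV. osc_ranked \<epsilon> (b i) (\<lambda>x. S (Z i) x - S \<theta> x)) \<and>
       (\<forall>i\<in>UNIV. \<forall>j\<in>UNIV. i < j \<longrightarrow> oplus (B i) (b i) \<le> B j) \<and> (\<forall>i\<in>UNIV. oplus (B i) (b i) \<le> ?W)"
      using b(2) by blast
  qed
qed

text \<open>The block for \<open>d\<close> starts at \<open>omega_pow d\<close> and, as powers of
  \<open>omega\<close> are closed under addition, ends before
  \<open>omega_pow (osucc d)\<close>.\<close>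

lemma threshold_ranked_limit:
  assumes "is_limit \<kappa>" "\<And>d. d < \<kappa> \<Longrightarrow> blocks_ranked d"
  shows "threshold_ranked \<theta> (oplus \<theta> (omega_pow \<kappa>)) (omega_pow \<kappa>)"
proof -
  have limW: "is_limit (omega_pow \<kappa>)" using is_limit_omega_pow is_limit_pos assms(1) by blast
  show ?thesis
  proof (rule threshold_rankedI[of "{..<\<kappa>}" "\<lambda>d. oplus \<theta> (omega_pow d)"])
    show "oplus \<theta> (omega_pow d) < oplus \<theta> (omega_pow \<kappa>)" if "d \<in> {..<\<kappa>}" for d
      using that by (simp add: omega_pow_strict_mono)
    show "\<exists>d\<in>{..<\<kappa>}. m \<le> oplus \<theta> (omega_pow d)" if m: "m < oplus \<theta> (omega_pow \<kappa>)" for m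
    proof -
      obtain c where c: "c < omega_pow \<kappa>" "m < oplus \<theta> c" using m less_oplus_limit_iff[OF limW] by blast
      then obtain d where d: "d < \<kappa>" "c < omega_pow d" using less_omega_pow_limit_iff[OF assms(1)] by blast
      then have "m < oplus \<theta> (omega_pow d)" using c(2) by (meson oplus_strict_mono order_less_trans)
      then show ?thesis using d by (auto intro: less_imp_le)
    qed
    fix \<epsilon> :: real assume "\<epsilon> > 0"
    then have "\<forall>d\<in>{..<\<kappa>}. \<exists>b. b < omega_pow (osucc d) \<and>
        osc_ranked \<epsilon> b (\<lambda>x. S (oplus \<theta> (omega_pow d)) x - S \<theta> x)"
      using assms(2) unfolding blocks_ranked_def by blast
    then obtain b where b: "\<And>d. d < \<kappa> \<Longrightarrow> b d < omega_pow (osucc d)"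
        "\<And>d. d < \<kappa> \<Longrightarrow> osc_ranked \<epsilon> (b d) (\<lambda>x. S (oplus \<theta> (omega_pow d)) x - S \<theta> x)"
      unfolding bchoice_iff by auto
    have less: "oplus (omega_pow d) (b d) < omega_pow (osucc d)" if "d < \<kappa>" for d
      using b(1)[OF that] omega_pow_less_osucc by (rule oplus_less_omega_pow[rotated])
    have "oplus (omega_pow i) (b i) \<le> omega_pow j" if "i < j" "i < \<kappa>" for i j
      using less[OF that(2)] omega_pow_mono[of "osucc i" j] that(1) by (simp add: osucc_le_iff)
    then show "\<exists>b B. (\<forall>i\<in>{..<\<kappa>}. osc_ranked \<epsilon> (b i) (\<lambda>x. S (oplus \<theta> (omega_pow i)) x - S \<theta> x)) \<and>
       (\<forall>i\<in>{..<\<kappa>}. \<forall>j\<in>{..<\<kappa>}. i < j \<longrightarrow> oplus (B i) (b i) \<le> B j) \<and>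
       (\<forall>i\<in>{..<\<kappa>}. oplus (B i) (b i) \<le> omega_pow \<kappa>)"
      using b(2) by (intro exI[of _ b] exI[of _ omega_pow]) auto
  qed
qed

lemma threshold_ranked_omega_pow:
  assumes "0 < \<kappa>" "\<And>d. d < \<kappa> \<Longrightarrow> blocks_ranked d"
  shows "threshold_ranked \<theta> (oplus \<theta> (omega_pow \<kappa>)) (omega_pow \<kappa>)"
  by (cases \<kappa> rule: ordinal_cases) (use assms threshold_ranked_succ threshold_ranked_limit in auto)

text \<open>For exponent \<open>0\<close> the block is a single term, with a finite rank. For larger
  exponents the shorter blocks give threshold ranks, and finitely many of these are summed, which
  stays below the next power of \<open>omega\<close>.\<close>

lemma blocks_ranked: "blocks_ranked \<kappa>"
proof (induction \<kappa> rule: less_induct)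
  case (less \<kappa>)
  show ?case
  proof (cases "\<kappa> = 0")
    case True
    obtain M where M: "\<And>x. f 0 x \<le> M" using bdd by blast
    have "is_limit (omega_pow (osucc 0))" by (rule is_limit_omega_pow) simp
    then have fin: "(osucc ^^ n) 0 < omega_pow (osucc 0)" for n
      using finite_ordinal_less omega_pow_pos by blast
    show ?thesis unfolding blocks_ranked_def
    proof (intro allI impI)
      fix \<theta> and \<epsilon> :: real assume "\<epsilon> > 0"
      have "f \<theta> x \<le> M" for x using M[of x] dec[of 0 \<theta> x] by simp
      then have "osc_ranked \<epsilon> ((osucc ^^ Suc (nat \<lfloor>M / \<epsilon>\<rfloor>)) 0) (f \<theta>)"
        using \<open>\<epsilon> > 0\<close> by (intro usc_imp_osc_ranked usc nonneg)
      then have "osc_ranked \<epsilon> ((osucc ^^ Suc (nat \<lfloor>M / \<epsilon>\<rfloor>)) 0)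
          (\<lambda>x. S (oplus \<theta> (omega_pow \<kappa>)) x - S \<theta> x)"
        by (rule osc_ranked_abs_cong) (simp add: True one_ordinal_eq ord_sign_def abs_minus_commute)
      then show "\<exists>b<omega_pow (osucc \<kappa>). osc_ranked \<epsilon> b (\<lambda>x. S (oplus \<theta> (omega_pow \<kappa>)) x - S \<theta> x)"
        using fin True by blast
    qed
  next
    case False
    then have pos: "0 < \<kappa>" using ordinal_zero_le order_le_less by metis
    show ?thesis unfolding blocks_ranked_def
    proof (intro allI impI threshold_ranked_imp_osc_ranked)
      fix \<theta>
      show "threshold_ranked \<theta> (oplus \<theta> (omega_pow \<kappa>)) (omega_pow \<kappa>)"
        using threshold_ranked_omega_pow pos less.IH by blast
      show "is_limit (oplus \<theta> (omega_pow \<kappa>))" by (intro is_limit_oplus is_limit_omega_pow pos)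
      show "0 < osucc \<kappa>" using pos osucc_greater order_less_trans by blast
    qed (rule omega_pow_less_osucc)
  qed
qed

theorem osc_ranked_alt_sum:
  assumes "0 < \<kappa>" "\<And>x \<epsilon>. \<epsilon> > 0 \<Longrightarrow> \<exists>\<zeta><omega_pow \<kappa>. f \<zeta> x < \<epsilon>" "\<epsilon> > 0"
  shows "osc_ranked \<epsilon> (omega_pow \<kappa>) (S (omega_pow \<kappa>))"
  using threshold_ranked_vanishing[OF threshold_ranked_omega_pow[OF assms(1) blocks_ranked, of 0], OF _ _ assms(3)]
    is_limit_omega_pow[OF assms(1)] assms(2) by simp

end

lemma usc_iff_eventually: "usc g \<longleftrightarrow> (\<forall>x c. g x < c \<longrightarrow> (\<forall>\<^sub>F y in nhds x. g y < c))"
proof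
  assume *: "\<forall>x c. g x < c \<longrightarrow> (\<forall>\<^sub>F y in nhds x. g y < c)"
  have "open {x. g x < c}" for c
    unfolding open_subopen[of "{x. g x < c}"]
  proof safe
    fix x assume "g x < c"
    with * have "\<forall>\<^sub>F y in nhds x. g y < c" by blast
    then show "\<exists>T. open T \<and> x \<in> T \<and> T \<subseteq> {x. g x < c}"
      unfolding eventually_nhds by blast
  qed
  then show "usc g" by (simp add: usc_def)
qed (simp add: usc_eventually_less)

text \<open>Allows padding with zeros up to a limit length. The alternating estimate pins the sum at
  \<open>\<theta>\<close> to that at the even stage \<open>\<mu>\<close> or
  \<open>osucc \<mu>\<close>.\<close>

lemma (in usc_chain) alt_sum_eventually_zero:
  assumes zero: "\<And>\<eta> x. \<mu> \<le> \<eta> \<Longrightarrow> f \<eta> x = 0" and "is_limit \<theta>" "\<mu> \<le> \<theta>"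
  shows "alt_sum f \<theta> x = alt_sum f \<mu> x"
proof (cases "even_ord \<mu>")
  case True
  then show ?thesis using alt_sum_bounds[of \<mu> \<theta> x] assms zero[of \<mu> x] zero[of \<theta> x]
    by (simp add: even_ord_limit del: alt_sum.simps)
next
  case False
  then have "\<mu> < \<theta>" using assms even_ord_limit order_le_less by metis
  then have "osucc \<mu> \<le> \<theta>" by (simp add: osucc_le_iff)
  moreover have "alt_sum f (osucc \<mu>) x = alt_sum f \<mu> x" using zero[of \<mu> x] by simp
  ultimately show ?thesis
    using alt_sum_bounds[of "osucc \<mu>" \<theta> x] False zero[of "osucc \<mu>" x] zero[of \<theta> x] assms
    by (simp add: even_ord_limit less_imp_le del: alt_sum.simps)
qed

lemma alt_sum_cong: "(\<And>\<eta>. \<eta> < \<theta> \<Longrightarrow> f \<eta> = g \<eta>) \<Longrightarrow> alt_sum f \<theta> = alt_sum g \<theta>"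
proof (induction \<theta> rule: less_induct)
  case (less \<theta>)
  have IH: "alt_sum f \<eta> = alt_sum g \<eta>" if "\<eta> < \<theta>" for \<eta>
    using less that order_less_trans by blast
  show ?case
  proof (cases \<theta> rule: ordinal_cases)
    case (succ d)
    then show ?thesis using IH[of d] less.prems[of d] by simp
  next
    case limit
    then show ?thesis using IH by (auto intro!: ext SUP_cong)
  qed simp
qed

lemma alt_sum_imp_osc_ranked:
  assumes "(\<mu>, g) \<in> DUSB1" "0 < \<kappa>" "\<mu> \<le> omega_pow \<kappa>" "\<epsilon> > 0"
  shows "osc_ranked \<epsilon> (omega_pow \<kappa>) (alt_sum g \<mu>)"
proof -
  \<comment> \<open>Values of \<open>g\<close> from \<open>\<mu>\<close> on are arbitrary, so they
    are replaced by zero.\<close>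
  define h where "h \<eta> = (if \<eta> < \<mu> then g \<eta> else (\<lambda>x. 0))" for \<eta>
  have lim: "is_limit (omega_pow \<kappa>)" by (rule is_limit_omega_pow[OF assms(2)])
  have g: "\<And>\<eta>. \<eta> < \<mu> \<Longrightarrow> usc (g \<eta>)" "\<And>\<eta>. \<eta> < \<mu> \<Longrightarrow> bounded (range (g \<eta>))"
    "\<And>\<eta> x. \<eta> < \<mu> \<Longrightarrow> 0 \<le> g \<eta> x" "\<And>\<zeta> \<eta> x. \<zeta> \<le> \<eta> \<Longrightarrow> \<eta> < \<mu> \<Longrightarrow> g \<eta> x \<le> g \<zeta> x"
    using assms(1) unfolding DUSB1_def by simp_all
  have van: "\<exists>\<zeta><\<mu>. \<forall>\<eta>. \<zeta> \<le> \<eta> \<and> \<eta> < \<mu> \<longrightarrow> \<bar>g \<eta> x\<bar> < \<delta>" if "is_limit \<mu>" "\<delta> > 0" for x \<delta>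
    using assms(1) that unfolding DUSB1_def by blast
  interpret usc_chain h
  proof
    fix \<zeta> \<eta> x
    show "usc (h \<eta>)" using g(1) by (auto simp: h_def usc_def)
    show "0 \<le> h \<eta> x" using g(3) by (auto simp: h_def)
    show "\<zeta> \<le> \<eta> \<Longrightarrow> h \<eta> x \<le> h \<zeta> x" using g(3,4) by (auto simp: h_def)
    show "\<exists>M. \<forall>x. h 0 x \<le> M"
    proof (cases "0 < \<mu>")
      case True
      then obtain M where "\<forall>x. \<bar>g 0 x\<bar> \<le> M" using g(2)[of 0] by (auto simp: bounded_iff)
      then show ?thesis using True by (intro exI[of _ M]) (auto simp: h_def abs_le_iff)
    qed (auto simp: h_def)
  qed
  have zero: "h \<eta> x = 0" if "\<mu> \<le> \<eta>" for \<eta> x using that by (simp add: h_def)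
  \<comment> \<open>At full length the convergence clause of \<open>DUSB1\<close> applies; for a
    shorter sequence the padded term at \<open>\<mu>\<close> is already zero.\<close>
  have "\<exists>\<zeta><omega_pow \<kappa>. h \<zeta> x < \<delta>" if pos: "\<delta> > 0" for x \<delta>
  proof (cases "\<mu> = omega_pow \<kappa>")
    case True
    then obtain \<zeta> where "\<zeta> < \<mu>" "\<bar>g \<zeta> x\<bar> < \<delta>" using van[of \<delta> x] lim pos by blast
    then show ?thesis using True by (intro exI[of _ \<zeta>]) (auto simp: h_def)
  next
    case False
    then have "\<mu> < omega_pow \<kappa>" using assms(3) by simp
    then show ?thesis using zero[of \<mu> x] pos by (intro exI[of _ \<mu>]) simp
  qed
  then have "osc_ranked \<epsilon> (omega_pow \<kappa>) (alt_sum h (omega_pow \<kappa>))"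
    using assms by (intro osc_ranked_alt_sum)
  moreover have "alt_sum h (omega_pow \<kappa>) = alt_sum h \<mu>"
    using alt_sum_eventually_zero[OF zero lim assms(3)] by blast
  moreover have "alt_sum h \<mu> = alt_sum g \<mu>"
    by (rule alt_sum_cong) (simp add: h_def)
  ultimately show ?thesis by simp
qed

subsection \<open>Alternating sums from series of rank parities\<close>

text \<open>The indicator is constant on the level sets of \<open>\<sigma>\<close>, so
  \<open>\<sigma>\<close> itself serves for every \<open>\<epsilon>\<close>.\<close>

lemma osc_ranked_even:
  assumes "usc_rank \<sigma>" "\<And>x. \<sigma> x < b" "\<epsilon> > 0"
  shows "osc_ranked \<epsilon> b (\<lambda>x. c * of_bool (even_ord (\<sigma> x)))"
  by (rule osc_rankedI[OF assms(1,2)]) (use assms(3) in simp)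

text \<open>The residue again has ranks below the same power of \<open>omega\<close>, by closure
  under natural sums; this permits iteration.\<close>

lemma greedy_step:
  assumes f: "\<And>\<epsilon>. \<epsilon> > 0 \<Longrightarrow> osc_ranked \<epsilon> (omega_pow \<kappa>) f" and "\<And>x. 0 \<le> f x" "\<And>x. f x \<le> M"
    and "M > 0" "0 < \<kappa>"
  obtains \<sigma> where "usc_rank \<sigma>" "\<And>x. \<sigma> x < omega_pow \<kappa>"
    "\<And>x. 0 \<le> f x - M / 3 * of_bool (even_ord (\<sigma> x))" 
    "\<And>x. f x - M / 3 * of_bool (even_ord (\<sigma> x)) \<le> 2 / 3 * M"
    "\<And>\<epsilon>. \<epsilon> > 0 \<Longrightarrow> osc_ranked \<epsilon> (omega_pow \<kappa>) (\<lambda>x. f x - M / 3 * of_bool (even_ord (\<sigma> x)))"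
proof -
  \<comment> \<open>\<open>rank_separated\<close> makes ranks even on the lower set; passing to
    \<open>- f\<close> puts even ranks where \<open>f\<close> is large.\<close>
  have "osc_ranked (- (M / 3) - - (2 / 3 * M)) (omega_pow \<kappa>) (\<lambda>x. - f x)"
    using assms(4) by (intro osc_ranked_uminus f) simp
  then have "rank_separated (omega_pow \<kappa>) {x. - f x \<le> - (2 / 3 * M)} {x. - (M / 3) \<le> - f x}"
    using is_limit_omega_pow[OF assms(5)] by (intro osc_ranked_imp_separated)
  then obtain \<sigma> where \<sigma>: "usc_rank \<sigma>" "\<And>x. \<sigma> x < omega_pow \<kappa>"
    "\<And>x. 2 / 3 * M \<le> f x \<Longrightarrow> even_ord (\<sigma> x)" "\<And>x. f x \<le> M / 3 \<Longrightarrow> \<not> even_ord (\<sigma> x)"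
    unfolding rank_separated_def by auto
  show thesis
  proof (rule that[OF \<sigma>(1,2)])
    fix x
    show "0 \<le> f x - M / 3 * of_bool (even_ord (\<sigma> x))" using \<sigma>(4)[of x] assms(2)[of x] by fastforce
    show "f x - M / 3 * of_bool (even_ord (\<sigma> x)) \<le> 2 / 3 * M"
      using \<sigma>(3)[of x] assms(3)[of x] by fastforce
  next
    fix \<epsilon> :: real assume "\<epsilon> > 0"
    then have "osc_ranked (\<epsilon>/2 + \<epsilon>/2) (omega_pow \<kappa>) (\<lambda>x. f x + (- (M / 3)) * of_bool (even_ord (\<sigma> x)))"
      using \<sigma>(1,2) by (intro osc_ranked_add[OF f osc_ranked_even]) (auto intro: nsum_less_omega_pow)
    then show "osc_ranked \<epsilon> (omega_pow \<kappa>) (\<lambda>x. f x - M / 3 * of_bool (even_ord (\<sigma> x)))" by simp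
  qed
qed

lemma osc_ranked_imp_series:
  assumes f: "\<And>\<epsilon>. \<epsilon> > 0 \<Longrightarrow> osc_ranked \<epsilon> (omega_pow \<kappa>) f" and "\<And>x. 0 \<le> f x" "\<And>x. f x \<le> M"
    and "M > 0" "0 < \<kappa>"
  obtains \<sigma> :: "nat \<Rightarrow> 'a::topological_space \<Rightarrow> ordinal" where "\<And>k. usc_rank (\<sigma> k)" "\<And>k x. \<sigma> k x < omega_pow \<kappa>"
    "\<And>x. (\<lambda>k. (2 / 3) ^ k * (M / 3) * of_bool (even_ord (\<sigma> k x))) sums f x"
proof -
  \<comment> \<open>The clause for \<open>n = 0\<close> ties the start of the chosen sequence to
    \<open>f\<close>, as dependent choice only returns the stated properties.\<close>
  define P where "P n g \<longleftrightarrow> (\<forall>\<epsilon>>0. osc_ranked \<epsilon> (omega_pow \<kappa>) g) \<and> (\<forall>x. 0 \<le> g x \<and> g x \<le> (2 / 3) ^ n * M)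
    \<and> (n = 0 \<longrightarrow> g = f)" for n :: nat and g
  define Q where "Q n g \<sigma> g' \<longleftrightarrow> usc_rank \<sigma> \<and> (\<forall>x. \<sigma> x < omega_pow \<kappa>) \<and>
    g' = (\<lambda>x. g x - (2 / 3) ^ n * (M / 3) * of_bool (even_ord (\<sigma> x)))" 
    for n :: nat and g \<sigma> and g' :: "'a \<Rightarrow> real"
  have "\<exists>G. \<forall>n. P n (G n) \<and> (\<exists>\<sigma>. Q n (G n) \<sigma> (G (Suc n)))"
  proof (rule dependent_nat_choice)
    show "\<exists>g. P 0 g" using assms by (intro exI[of _ f]) (simp add: P_def)
    fix g n assume P: "P n g"
    have "(2 / 3) ^ n * M > 0" using assms(4) by simp
    with P obtain \<sigma> where \<sigma>: "usc_rank \<sigma>" "\<And>x. \<sigma> x < omega_pow \<kappa>"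
      "\<And>x. 0 \<le> g x - ((2 / 3) ^ n * M) / 3 * of_bool (even_ord (\<sigma> x))" 
      "\<And>x. g x - ((2 / 3) ^ n * M) / 3 * of_bool (even_ord (\<sigma> x)) \<le> 2 / 3 * ((2 / 3) ^ n * M)"
      "\<And>\<epsilon>. \<epsilon> > 0 \<Longrightarrow> osc_ranked \<epsilon> (omega_pow \<kappa>) (\<lambda>x. g x - ((2 / 3) ^ n * M) / 3 * of_bool (even_ord (\<sigma> x)))"
      using greedy_step[of \<kappa> g "(2 / 3) ^ n * M"] assms(5) unfolding P_def by blast
    define g' where "g' = (\<lambda>x. g x - (2 / 3) ^ n * (M / 3) * of_bool (even_ord (\<sigma> x)))"
    have "P (Suc n) g'" "Q n g \<sigma> g'" using \<sigma> by (simp_all add: P_def Q_def g'_def mult.assoc)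
    then show "\<exists>g'. P (Suc n) g' \<and> (\<exists>\<sigma>. Q n g \<sigma> g')" by blast
  qed
  then obtain G where G: "\<And>n. P n (G n)" "\<forall>n. \<exists>\<sigma>. Q n (G n) \<sigma> (G (Suc n))" by blast
  from G(2) obtain \<sigma> where \<sigma>: "\<And>n. Q n (G n) (\<sigma> n) (G (Suc n))" unfolding choice_iff by blast
  have "(\<lambda>k. (2 / 3) ^ k * (M / 3) * of_bool (even_ord (\<sigma> k x))) sums f x" for x
  proof -
    have "(\<Sum>k<n. (2 / 3) ^ k * (M / 3) * of_bool (even_ord (\<sigma> k x))) = f x - G n x" for n
    proof (induction n)
      case 0
      then show ?case using G(1)[of 0] by (simp add: P_def)
    next
      case (Suc n)
      then show ?case using \<sigma>[of n] by (simp add: Q_def)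
    qed
    moreover have "(\<lambda>n. G n x) \<longlonglongrightarrow> 0"
    proof (rule tendsto_sandwich[OF _ _ tendsto_const])
      show "(\<lambda>n. (2 / 3 :: real) ^ n * M) \<longlonglongrightarrow> 0" by real_asymp
    qed (use G(1) in \<open>auto simp: P_def\<close>)
    then have "(\<lambda>n. f x - G n x) \<longlonglongrightarrow> f x - 0" by (intro tendsto_intros)
    ultimately show ?thesis by (simp add: sums_def)
  qed
  then show thesis using that[of \<sigma>] \<sigma> unfolding Q_def by blast
qed

section \<open>The decreasing sequence obtained from a weighted series of ranks\<close>

locale rank_series =
  fixes c :: "nat \<Rightarrow> real" and \<sigma> :: "nat \<Rightarrow> 'a::topological_space \<Rightarrow> ordinal"
  assumes c_nonneg: "0 \<le> c k" and summable_c: "summable c" and usc_rank: "usc_rank (\<sigma> k)"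
begin

definition layer :: "ordinal \<Rightarrow> 'a \<Rightarrow> real" where
  "layer \<eta> x = (\<Sum>k. c k * of_bool (\<eta> \<le> \<sigma> k x))"

lemma summable_of_bool: "summable (\<lambda>k. c k * of_bool (P k))"
  by (rule summable_comparison_test'[OF summable_c, of 0]) (simp add: c_nonneg)

lemma suminf_of_bool_mono:
  "(\<And>k. P k \<Longrightarrow> Q k) \<Longrightarrow> (\<Sum>k. c k * of_bool (P k)) \<le> (\<Sum>k. c k * of_bool (Q k))"
  by (intro suminf_le summable_of_bool mult_left_mono c_nonneg) auto

text \<open>One cutoff \<open>n\<close> serves all predicates, hence all points and all stages at
  once.\<close>

lemma small_tail:
  assumes "\<epsilon> > 0"
  obtains n where "\<And>P. (\<Sum>k. c k * of_bool (P k)) < (\<Sum>k<n. c k * of_bool (P k)) + \<epsilon>"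
proof -
  obtain n where n: "norm (\<Sum>i. c (i + n)) < \<epsilon>"
    using suminf_exist_split[OF assms summable_c] by blast
  have "(\<Sum>k. c k * of_bool (P k)) < (\<Sum>k<n. c k * of_bool (P k)) + \<epsilon>" for P
  proof -
    have "(\<Sum>i. c (i + n) * of_bool (P (i + n))) \<le> (\<Sum>i. c (i + n))"
      using summable_ignore_initial_segment[OF summable_of_bool[of P], of n]
        summable_ignore_initial_segment[OF summable_c, of n]
      by (intro suminf_le) (auto simp: c_nonneg)
    moreover have "(\<Sum>k. c k * of_bool (P k)) = 
        (\<Sum>i. c (i + n) * of_bool (P (i + n))) + (\<Sum>k<n. c k * of_bool (P k))"
      by (rule suminf_split_initial_segment[OF summable_of_bool])
    ultimately show ?thesis using n by simp
  qed
  then show thesis using that by blast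
qed

text \<open>Near \<open>x\<close> the first \<open>n\<close> ranks do not rise, so the head of the
  series does not grow, and the tail is uniformly small.\<close>

lemma usc_layer: "usc (layer \<eta>)"
  unfolding usc_iff_eventually
proof (intro allI impI)
  fix x a assume "layer \<eta> x < a"
  then have "a - layer \<eta> x > 0" by simp
  then obtain n where n: "\<And>P. (\<Sum>k. c k * of_bool (P k)) < (\<Sum>k<n. c k * of_bool (P k)) + (a - layer \<eta> x)"
    by (rule small_tail) blast
  have "\<forall>\<^sub>F y in nhds x. \<forall>k<n. \<sigma> k y \<le> \<sigma> k x"
    using usc_rank by (intro eventually_all_less) (auto dest: usc_rankD)
  then show "\<forall>\<^sub>F y in nhds x. layer \<eta> y < a"
  proof eventually_elim
    case (elim y)
    have "(\<Sum>k<n. c k * of_bool (\<eta> \<le> \<sigma> k y)) \<le> (\<Sum>k<n. c k * of_bool (\<eta> \<le> \<sigma> k x))"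
      using elim by (intro sum_mono mult_left_mono c_nonneg) (auto intro: order_trans)
    also have "\<dots> \<le> layer \<eta> x"
      unfolding layer_def by (rule sum_le_suminf[OF summable_of_bool]) (auto simp: c_nonneg)
    finally show ?case using n[of "\<lambda>k. \<eta> \<le> \<sigma> k y"] unfolding layer_def by linarith
  qed
qed

text \<open>Supplies one even stage past finitely many ranks, which allows a limit stage to be
  exchanged with the series.\<close>

lemma limit_above_finite:
  fixes n :: nat
  assumes "is_limit \<theta>"
  shows "\<exists>\<zeta><\<theta>. even_ord \<zeta> \<and> (\<forall>k<n. s k < \<theta> \<longrightarrow> s k < \<zeta>)"
proof (induction n)
  case 0
  then show ?case using is_limit_pos[OF assms] by (intro exI[of _ 0]) simp
next
  case (Suc n)
  then obtain \<zeta> where \<zeta>: "\<zeta> < \<theta>" "even_ord \<zeta>" "\<forall>k<n. s k < \<theta> \<longrightarrow> s k < \<zeta>" by blast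
  show ?case
  proof (cases "s n < \<theta>")
    case True
    define \<xi> where "\<xi> = osucc (max \<zeta> (s n))"
    have \<xi>: "\<xi> < \<theta>" "\<zeta> < \<xi>" "s n < \<xi>" 
      using \<zeta> True is_limit_osucc[OF assms] by (auto simp: \<xi>_def less_osucc_iff)
    define \<xi>' where "\<xi>' = (if even_ord \<xi> then \<xi> else osucc \<xi>)"
    have "\<xi>' < \<theta>" "even_ord \<xi>'" "\<xi> \<le> \<xi>'" 
      using \<xi> is_limit_osucc[OF assms] by (auto simp: \<xi>'_def less_imp_le)
    moreover from this have "\<forall>k<Suc n. s k < \<theta> \<longrightarrow> s k < \<xi>'"
      using \<xi> \<zeta>(3) by (metis less_Suc_eq order_less_le_trans order_less_trans)
    ultimately show ?thesis by blast
  qed (use \<zeta> less_Suc_eq in metis)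
qed

text \<open>Each \<open>k\<close> contributes alternating copies of \<open>c k\<close> up to stage
  \<open>\<sigma> k x\<close>: once that stage is passed, \<open>c k\<close> survives exactly for
  even rank; before that, exactly at odd \<open>\<theta>\<close>. At a limit above all ranks only
  the parities remain.\<close>

lemma alt_sum_layer:
  "alt_sum layer \<theta> x =
    (\<Sum>k. c k * of_bool (\<sigma> k x < \<theta> \<and> even_ord (\<sigma> k x) \<or> \<not> even_ord \<theta> \<and> \<theta> \<le> \<sigma> k x))"
proof (induction \<theta> rule: less_induct)
  case (less \<theta>)
  show ?case
  proof (cases \<theta> rule: ordinal_cases)
    case (succ d)
    let ?s = "\<lambda>k. c k * of_bool (\<sigma> k x < d \<and> even_ord (\<sigma> k x) \<or> \<not> even_ord d \<and> d \<le> \<sigma> k x)"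
    have step: "?s k + ord_sign d * (c k * of_bool (d \<le> \<sigma> k x)) =
        c k * of_bool (\<sigma> k x < \<theta> \<and> even_ord (\<sigma> k x) \<or> \<not> even_ord \<theta> \<and> \<theta> \<le> \<sigma> k x)" for k
      by (cases "\<sigma> k x" d rule: linorder_cases)
        (auto simp: succ ord_sign_def osucc_le_iff less_osucc_iff)
    have "alt_sum layer \<theta> x = (\<Sum>k. ?s k) + ord_sign d * layer d x"
      using less.IH[of d] succ by simp
    also have "\<dots> = (\<Sum>k. ?s k + ord_sign d * (c k * of_bool (d \<le> \<sigma> k x)))"
      by (simp only: layer_def suminf_mult[OF summable_of_bool, symmetric]
          suminf_add[OF summable_of_bool summable_mult[OF summable_of_bool]])
    also have "\<dots> = (\<Sum>k. c k * of_bool (\<sigma> k x < \<theta> \<and> even_ord (\<sigma> k x) \<or> \<not> even_ord \<theta> \<and> \<theta> \<le> \<sigma> k x))"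
      by (simp only: step)
    finally show ?thesis .
  next
    case limit
    have ev: "even_ord \<theta>" using limit by (rule even_ord_limit)
    let ?A = "{\<zeta>. \<zeta> < \<theta> \<and> even_ord \<zeta>}"
    let ?T = "\<lambda>\<zeta>. \<Sum>k. c k * of_bool (\<sigma> k x < \<zeta> \<and> even_ord (\<sigma> k x))"
    have S: "alt_sum layer \<theta> x = (SUP \<zeta>\<in>?A. ?T \<zeta>)"
      using limit less.IH by (auto intro!: SUP_cong)
    have le: "?T \<zeta> \<le> ?T \<theta>" if "\<zeta> \<in> ?A" for \<zeta>
      using that by (intro suminf_of_bool_mono) (auto intro: order_less_trans)
    then have bdd: "bdd_above (?T ` ?A)" by (intro bdd_aboveI[of _ "?T \<theta>"]) auto
    have "0 \<in> ?A" using is_limit_pos[OF limit] by simp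
    have "(SUP \<zeta>\<in>?A. ?T \<zeta>) = ?T \<theta>"
    proof (rule antisym)
      show "(SUP \<zeta>\<in>?A. ?T \<zeta>) \<le> ?T \<theta>" using \<open>0 \<in> ?A\<close> le by (intro cSUP_least) blast+
      show "?T \<theta> \<le> (SUP \<zeta>\<in>?A. ?T \<zeta>)"
      \<comment> \<open>Each finite part of the series is already present at an even stage beyond
        those of its ranks that lie below \<open>\<theta>\<close>.\<close>
      proof (rule suminf_le_const[OF summable_of_bool])
        fix n
        obtain \<zeta> where \<zeta>: "\<zeta> \<in> ?A" "\<forall>k<n. \<sigma> k x < \<theta> \<longrightarrow> \<sigma> k x < \<zeta>"
          using limit_above_finite[OF limit, of n "\<lambda>k. \<sigma> k x"] by blast
        have "(\<Sum>k<n. c k * of_bool (\<sigma> k x < \<theta> \<and> even_ord (\<sigma> k x)))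
            \<le> (\<Sum>k<n. c k * of_bool (\<sigma> k x < \<zeta> \<and> even_ord (\<sigma> k x)))"
          using \<zeta>(2) by (intro sum_mono mult_left_mono c_nonneg) auto
        also have "\<dots> \<le> ?T \<zeta>" by (rule sum_le_suminf[OF summable_of_bool]) (auto simp: c_nonneg)
        also have "\<dots> \<le> (SUP \<zeta>\<in>?A. ?T \<zeta>)" using \<zeta>(1) bdd by (rule cSUP_upper)
        finally show "(\<Sum>k<n. c k * of_bool (\<sigma> k x < \<theta> \<and> even_ord (\<sigma> k x))) \<le> (SUP \<zeta>\<in>?A. ?T \<zeta>)" .
      qed
    qed
    then show ?thesis using S ev by simp
  qed simp
qed

text \<open>Convergence to zero holds because some stage below the limit \<open>W\<close> passes the
  first \<open>n\<close> ranks at \<open>x\<close>, leaving only the small tail.\<close>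

lemma layer_in_DUSB1:
  assumes "is_limit W" "W < omega1" "\<And>k x. \<sigma> k x < W"
  shows "(W, layer) \<in> DUSB1"
proof -
  have nonneg: "0 \<le> layer \<eta> x" for \<eta> x
    unfolding layer_def by (intro suminf_nonneg summable_of_bool) (simp add: c_nonneg)
  have le: "layer \<eta> x \<le> suminf c" for \<eta> x
    using suminf_of_bool_mono[of "\<lambda>k. \<eta> \<le> \<sigma> k x" "\<lambda>k. True"] by (simp add: layer_def)
  have "bounded (range (layer \<eta>))" for \<eta>
    unfolding bounded_iff using nonneg le by (intro exI[of _ "suminf c"]) auto
  moreover have "layer \<eta> x \<le> layer \<zeta> x" if "\<zeta> \<le> \<eta>" for \<zeta> \<eta> x
    unfolding layer_def using that by (intro suminf_of_bool_mono) auto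
  moreover have "\<exists>\<zeta><W. \<forall>\<eta>. \<zeta> \<le> \<eta> \<and> \<eta> < W \<longrightarrow> \<bar>layer \<eta> x\<bar> < \<epsilon>" if "\<epsilon> > 0" for x \<epsilon>
  proof -
    obtain n where n: "\<And>P. (\<Sum>k. c k * of_bool (P k)) < (\<Sum>k<n. c k * of_bool (P k)) + \<epsilon>"
      using \<open>\<epsilon> > 0\<close> by (rule small_tail) blast
    obtain \<zeta> where \<zeta>: "\<zeta> < W" "\<forall>k<n. \<sigma> k x < \<zeta>"
      using limit_above_finite[OF assms(1), of n "\<lambda>k. \<sigma> k x"] assms(3) by blast
    have "\<bar>layer \<eta> x\<bar> < \<epsilon>" if "\<zeta> \<le> \<eta>" for \<eta>
    proof -
      have "(\<Sum>k<n. c k * of_bool (\<eta> \<le> \<sigma> k x)) = 0"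
        using \<zeta>(2) that by (intro sum.neutral) (auto simp: not_le intro: order_less_le_trans)
      then show ?thesis using n[of "\<lambda>k. \<eta> \<le> \<sigma> k x"] nonneg[of \<eta> x] by (simp add: layer_def)
    qed
    then show ?thesis using \<zeta>(1) by blast
  qed
  ultimately show ?thesis
    unfolding DUSB1_def using assms(2) usc_layer nonneg by simp
qed

end

lemma osc_ranked_imp_alt_sum_representation:
  fixes f :: "'a::topological_space \<Rightarrow> real"
  assumes f: "\<And>\<epsilon>. \<epsilon> > 0 \<Longrightarrow> osc_ranked \<epsilon> (omega_pow \<kappa>) f" and "bounded (range f)"
    and "0 < \<kappa>" "\<kappa> < omega1"
  shows "alt_sum_representation f (omega_pow \<kappa>)"
proof -
  obtain m where "\<forall>x. \<bar>f x\<bar> \<le> m" using assms(2) by (auto simp: bounded_iff)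
  then have "\<bar>f x\<bar> \<le> m" for x by blast
  \<comment> \<open>Shifting by \<open>m\<close> makes the function nonnegative; the summand
    \<open>1\<close> keeps the upper bound positive even if \<open>m\<close> is zero.\<close>
  then have m: "0 \<le> f x + m" "f x + m \<le> 2 * \<bar>m\<bar> + 1" for x
    by (smt (verit))+
  have ranked: "osc_ranked \<epsilon> (omega_pow \<kappa>) (\<lambda>x. f x + m)" if "\<epsilon> > 0" for \<epsilon>
    using f[OF that] by (rule osc_ranked_abs_cong) simp
  have "2 * \<bar>m\<bar> + 1 > 0" by simp
  then obtain \<sigma> where \<sigma>: "\<And>k. usc_rank (\<sigma> k)" "\<And>k x. \<sigma> k x < omega_pow \<kappa>"
    "\<And>x. (\<lambda>k. (2 / 3) ^ k * ((2 * \<bar>m\<bar> + 1) / 3) * of_bool (even_ord (\<sigma> k x))) sums (f x + m)"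
    using osc_ranked_imp_series[OF ranked m _ assms(3)] by blast
  define c where "c k = (2 / 3) ^ k * ((2 * \<bar>m\<bar> + 1) / 3)" for k :: nat
  have "summable c"
    unfolding c_def[abs_def] by (intro summable_mult2 summable_geometric) simp
  then interpret rank_series c \<sigma>
    by unfold_locales (simp_all add: c_def \<sigma>)
  have lim: "is_limit (omega_pow \<kappa>)" using assms(3) by (rule is_limit_omega_pow)
  have "alt_sum layer (omega_pow \<kappa>) x = f x + m" for x
    unfolding alt_sum_layer using \<sigma>(2,3) even_ord_limit[OF lim]
    by (simp add: c_def sums_iff)
  then have "f = (\<lambda>x. - m + alt_sum layer (omega_pow \<kappa>) x)" by auto
  moreover have "(omega_pow \<kappa>, layer) \<in> DUSB1"
    using lim omega_pow_less_omega1[OF assms(4)] \<sigma>(2) by (rule layer_in_DUSB1)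
  ultimately show ?thesis unfolding alt_sum_representation_def by blast
qed

section \<open>The equivalence, by comparing both sides with ranks of small oscillation\<close>

theorem theorem3p4:
  fixes f :: "'a::polish_space \<Rightarrow> real" and \<Lambda> :: ordinal
  assumes "uncountable (UNIV :: 'a set)"
    and "bounded (range f)" and "baire_class_1 f"
    and "1 \<le> \<Lambda>" and "\<Lambda> < omega1"
  shows "f \<in> bounded_baire1 \<Lambda> \<longleftrightarrow> length1 f \<le> omega_pow \<Lambda>"
proof -
  have pos: "0 < \<Lambda>" using assms(4) by (simp add: one_ordinal_eq osucc_le_iff)
  note lim = is_limit_omega_pow[OF pos] and less = omega_pow_less_omega1[OF assms(5)]
  have "f \<in> bounded_baire1 \<Lambda> \<longleftrightarrow> (\<forall>\<epsilon>>0. osc_ranked \<epsilon> (omega_pow \<Lambda>) f)"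
    (is "?L \<longleftrightarrow> ?M")
  proof -
    have "?L \<longleftrightarrow> (\<forall>p\<in>\<rat>. \<forall>q\<in>\<rat>. p < q \<longrightarrow> rank_separated (omega_pow \<Lambda>) {x. f x \<le> p} {x. q \<le> f x})"
      using assms(2,3) alpha1_le_iff[OF lim less] by (simp add: bounded_baire1_def)
    also have "\<dots> \<longleftrightarrow> ?M"
      using separated_imp_osc_ranked[OF assms(2)]
      by (intro iffI) (blast, simp add: osc_ranked_imp_separated[OF lim])
    finally show ?thesis .
  qed
  also have "\<dots> \<longleftrightarrow> (\<exists>\<mu>\<le>omega_pow \<Lambda>. alt_sum_representation f \<mu>)"
  proof
    assume ?M
    then show "\<exists>\<mu>\<le>omega_pow \<Lambda>. alt_sum_representation f \<mu>"
      using osc_ranked_imp_alt_sum_representation assms(2,5) pos by blast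
  next
    assume "\<exists>\<mu>\<le>omega_pow \<Lambda>. alt_sum_representation f \<mu>"
    then obtain \<mu> g c where g: "\<mu> \<le> omega_pow \<Lambda>" "(\<mu>, g) \<in> DUSB1" "f = (\<lambda>x. c + alt_sum g \<mu> x)"
      unfolding alt_sum_representation_def by blast
    show ?M
    proof (intro allI impI)
      fix \<epsilon> :: real assume "\<epsilon> > 0"
      from alt_sum_imp_osc_ranked[OF g(2) pos g(1) this] show "osc_ranked \<epsilon> (omega_pow \<Lambda>) f"
        by (rule osc_ranked_abs_cong) (simp add: g(3))
    qed
  qed
  also have "\<dots> \<longleftrightarrow> length1 f \<le> omega_pow \<Lambda>"
  proof
    assume "\<exists>\<mu>\<le>omega_pow \<Lambda>. alt_sum_representation f \<mu>"
    then show "length1 f \<le> omega_pow \<Lambda>"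
      unfolding length1_def by (auto intro: order_trans[OF Least_le])
  next
    assume *: "length1 f \<le> omega_pow \<Lambda>"
    \<comment> \<open>As \<open>omega_pow \<Lambda> < omega1\<close>, the default value of
      \<open>length1\<close> is excluded.\<close>
    then have ex: "\<exists>\<mu>. alt_sum_representation f \<mu>"
      using less unfolding length1_def by (auto split: if_splits)
    then have "alt_sum_representation f (length1 f)"
      unfolding length1_def by (auto intro: LeastI_ex)
    then show "\<exists>\<mu>\<le>omega_pow \<Lambda>. alt_sum_representation f \<mu>" using * by blast
  qed
  finally show ?thesis .
qed

end
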